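(* Let $n \ge 1$, let $t > 0$, and let $p \in (1 + e^{-2t}, 2]$. Let $C > 0$ be a constant such that for all Borel sets $E', F' \subset \mathbb{R}^n$ and all $v \in L^2(\gamma)$, $$\|\mathbf{1}_{F'} e^{tL}(\mathbf{1}_{E'} v)\|_{L^2(\gamma)} \le C\, \frac{t}{\operatorname{dist}(E',F')} \exp\Bigl(-\frac{\operatorname{dist}(E',F')^2}{2t}\Bigr) \|\mathbf{1}_{E'} v\|_{L^2(\gamma)}.$$ Let $E, F$ be Borel subsets of $\mathbb{R}^n$. Then for all $u \in L^p(\gamma)$, $$\|\mathbf{1}_F e^{tL}(\mathbf{1}_E u)\|_{L^2(\gamma)} \le \biggl( \frac{Ct}{\operatorname{dist}(E,F)} \exp\Bigl(-\frac{\operatorname{dist}(E,F)^2}{2t}\Bigr)\biggr)^{1-\delta(p,t)} \|\mathbf{1}_E u\|_{L^p(\gamma)},$$ where $$\delta(p,t) := \frac{\frac12 - \frac1p}{\frac12 - \frac{1}{1+e^{-2t}}} \in [0,1).$$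
   Context: $\gamma$ is the Gaussian probability measure $d\gamma(x) = \pi^{-n/2} e^{-|x|^2}\,dx$ on $\mathbb{R}^n$, and $L^p(\gamma) = L^p(\mathbb{R}^n,\gamma)$ (complex-valued functions). The Ornstein--Uhlenbeck operator is $L = \frac12\Delta - \langle x,\nabla\rangle = -\frac12\nabla^*\nabla$, with $\nabla^*$ the adjoint of $\nabla$ in $L^2(\gamma)$; it generates the Ornstein--Uhlenbeck semigroup $(e^{tL})_{t>0}$, given by $$e^{tL}u(x) = \int_{\mathbb{R}^n} M_t(x,y)u(y)\,d\gamma(y),\qquad M_t(x,y) = \frac{1}{(1-e^{-2t})^{n/2}} \exp\Bigl(-e^{-2t}\frac{|x-y|^2}{1-e^{-2t}}\Bigr)\exp\Bigl(2e^{-t}\frac{\langle x,y\rangle}{1+e^{-t}}\Bigr).$$ The same formula defines $e^{tL}u$ for $u \in L^p(\gamma)$. For $E,F\subset\mathbb{R}^n$, $\operatorname{dist}(E,F) := \inf\{|x-y| : x\in E, y\in F\}$. The right-hand sides of the estimates are understood as $+\infty$ when $\operatorname{dist}(E,F)=0$ (so that the estimate is then trivial) and as $0$ when $E$ or $F$ is empty. The hypothesis on $C$ is the Davies--Gaffney-type $L^2$--$L^2$ estimate known as McIntosh's theorem, which provides the existence of such a constant $C$. *)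

theory Defs
  imports "HOL-Analysis.Analysis"
begin

definition gauss :: "(real ^ 'n) measure" where
  "gauss = density lborel
     (\<lambda>x. ennreal (pi powr (- real CARD('n) / 2) * exp (- (norm x)\<^sup>2)))"

text \<open>The \<open>L\<^sup>p\<close> norm (for real \<open>p > 0\<close>) takes values in \<open>[0, \<infinity>]\<close>, so that an inequality with a
  finite upper bound also asserts integrability. The case distinction is the power \<open>I powr (1/p)\<close> of
  \<open>I \<in> [0, \<infinity>]\<close>.\<close>

definition Lp_norm :: "real \<Rightarrow> 'a measure \<Rightarrow> ('a \<Rightarrow> complex) \<Rightarrow> ennreal" where
  "Lp_norm p M u =
     (let I = (\<integral>\<^sup>+ x. ennreal (norm (u x) powr p) \<partial>M)
      in if I = \<infinity> then \<infinity> else ennreal (enn2real I powr (1 / p)))"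

definition Lp_fun :: "real \<Rightarrow> 'a measure \<Rightarrow> ('a \<Rightarrow> complex) set" where
  "Lp_fun p M = {u \<in> borel_measurable M. Lp_norm p M u < \<infinity>}"

definition mehler_kernel :: "real \<Rightarrow> real ^ 'n \<Rightarrow> real ^ 'n \<Rightarrow> real" where
  "mehler_kernel t x y =
     1 / (1 - exp (- 2 * t)) powr (real CARD('n) / 2)
     * exp (- exp (- 2 * t) * (norm (x - y))\<^sup>2 / (1 - exp (- 2 * t)))
     * exp (2 * exp (- t) * (x \<bullet> y) / (1 + exp (- t)))"

text \<open>The Ornstein--Uhlenbeck semigroup \<open>e\<^bsup>tL\<^esup>\<close>. For \<open>t > 0\<close> and \<open>u \<in> L\<^sup>p(\<gamma>)\<close> with \<open>p > 1\<close>, the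
  integral converges absolutely at every \<open>x\<close>, since \<open>mehler_kernel t x\<close> is bounded.\<close>

definition OU_semigroup :: "real \<Rightarrow> (real ^ 'n \<Rightarrow> complex) \<Rightarrow> real ^ 'n \<Rightarrow> complex" where
  "OU_semigroup t u x = (LINT y|gauss. complex_of_real (mehler_kernel t x y) * u y)"

definition cutoff :: "'a set \<Rightarrow> ('a \<Rightarrow> complex) \<Rightarrow> 'a \<Rightarrow> complex" where
  "cutoff E u = (\<lambda>x. indicator E x * u x)"

text \<open>The right-hand side \<open>a * N\<close> of an off-diagonal estimate, with the conventions for degenerate
  distances. The empty case must come first: the distance to the empty set is \<open>\<infinity>\<close>, whereas
  \<^const>\<open>setdist\<close> returns \<open>0\<close> there.\<close>

definition offdiag_rhs ::
    "'a::metric_space set \<Rightarrow> 'a set \<Rightarrow> real \<Rightarrow> ennreal \<Rightarrow> ennreal" where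
  "offdiag_rhs E F a N =
     (if E = {} \<or> F = {} then 0 else if setdist E F = 0 then \<infinity> else ennreal a * N)"

definition delta :: "real \<Rightarrow> real \<Rightarrow> real" where
  "delta p t = (1 / 2 - 1 / p) / (1 / 2 - 1 / (1 + exp (- 2 * t)))"

end

theory Submission
  imports Defs "HOL-Probability.Characteristic_Functions" "HOL-Real_Asymp.Real_Asymp"
begin

text \<open>Write \<open>q = 1 + exp (- 2 t)\<close>. By Nelson's theorem \<open>e\<^bsup>tL\<^esup>\<close> is a contraction from \<open>L\<^sup>q(\<gamma>)\<close>
  to \<open>L\<^sup>2(\<gamma>)\<close>, and the claim interpolates between this bound and the hypothesis. As the kernel is
  positive, no complex interpolation is needed: for \<open>f \<ge> 0\<close>, Hoelder's inequality for the
  probability density \<open>M\<^sub>t(x, \<cdot>)\<close> bounds \<open>e\<^bsup>tL\<^esup>f\<close> pointwise by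
  \<open>(e\<^bsup>tL\<^esup>f\<^bsup>p/2\<^esup>)\<^bsup>1-\<delta>\<^esup> (e\<^bsup>tL\<^esup>f\<^bsup>p/q\<^esup>)\<^bsup>\<delta>\<^esup>\<close>.

  Nelson's theorem is proved in the bilinear form \<open>E f(Y) g(X) \<le> \<parallel>f\<parallel>\<^sub>q \<parallel>g\<parallel>\<^sub>2\<close> for Gaussian vectors
  \<open>X\<close>, \<open>Y\<close> with correlation \<open>exp (- t)\<close>. Its analogue for correlated random signs follows by induction
  from the Bonami--Beckner two-point inequality. For trigonometric polynomials the passage to
  the Gaussian limit is an explicit computation with characters, and it survives uniform limits,
  hence applies to \<open>\<bar>f\<bar>\<^sup>q\<close>; clamped trigonometric polynomials then approximate all bounded Borel
  functions.\<close>

section \<open>Hypercontractivity on the discrete cube\<close>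

text \<open>The exponent in Nelson's theorem originates on two points: damping the odd part of a
  function of one sign by a factor \<open>r\<close> maps \<open>L^q\<close> contractively into
  \<open>L^2\<close> when \<open>q - 1 = r^2\<close>, and \<open>r = exp (- t)\<close> turns this
  into \<open>q = 1 + exp (- 2 t)\<close>. The constant is 1, so it does not deteriorate as the
  number of signs grows. The bilinear form compares three integrals against one joint law, hence
  passes to limits, and the choice \<open>g = ou t f\<close> turns it back into an operator bound.
  Characters are the functions for which the limit is explicit, but \<open>|f|^q\<close> is in
  general no trigonometric polynomial even if \<open>f\<close> is one; the uniform closure is stable
  under continuous functions and repairs this. Clamping serves to keep approximants dominated. In
  the interpolation, \<open>\<delta>\<close> is fixed by
  \<open>1/p = (1 - \<delta>)/2 + \<delta>/q\<close>. The exponents \<open>p/2\<close> and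
  \<open>p/q\<close> are those for which the square of the first power and the \<open>q\<close>-th
  power of the second are both \<open>f^p\<close>.\<close>

lemma powr_diff_ge:
  fixes b q :: real
  assumes "0 \<le> b" "b \<le> 1" "0 < q" "q \<le> 1"
  shows "2 * q * b \<le> (1 + b) powr q - (1 - b) powr q"
proof -
  let ?f = "\<lambda>x. (1 + x) powr q - (1 - x) powr q - 2 * q * x"
  \<comment> \<open>Monotonicity is derived from the open interval only: for \<open>q < 1\<close>
    the power \<open>(1 - x) powr (q - 1)\<close> blows up at \<open>x = 1\<close>, which is the
    endpoint when \<open>b = 1\<close>.\<close>
  have "?f 0 \<le> ?f b"
  proof (rule DERIV_nonneg_imp_increasing_open[of 0 b ?f])
    show "0 \<le> b" by fact
    show "continuous_on {0..b} ?f"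
      using assms by (intro continuous_on_diff continuous_on_add continuous_on_powr' continuous_on_mult
          continuous_on_const continuous_on_id continuous_on_power) auto
    fix x assume x: "0 < x" "x < b"
    have pos: "1 + x > 0" "1 - x > 0" using x assms by auto
    have "(?f has_real_derivative q * (1 + x) powr (q - 1) + q * (1 - x) powr (q - 1) - 2 * q) (at x)"
      using pos by (auto intro!: derivative_eq_intros simp: field_simps)
    moreover have "0 \<le> q * (1 + x) powr (q - 1) + q * (1 - x) powr (q - 1) - 2 * q"
    proof -
      \<comment> \<open>Arithmetic-geometric mean: the two powers are the squares of
        \<open>?u\<close> and \<open>?v\<close>, whose product is a nonpositive power of
        \<open>1 - x^2\<close> and therefore at least 1.\<close>
      define m where "m = 1 - q"
      let ?u = "(1 + x) powr (- (m/2))" and ?v = "(1 - x) powr (- (m/2))"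
      have m: "0 \<le> m" using assms by (simp add: m_def)
      have uv: "?u * ?v = ((1 + x) * (1 - x)) powr (- (m/2))"
        using pos by (simp add: powr_mult)
      have "(1 + x) * (1 - x) \<le> 1" by (simp add: algebra_simps)
      then have "1 \<le> ((1 + x) * (1 - x)) powr (- (m/2))"
        using m pos powr_mono2'[of "- (m/2)" "(1 + x) * (1 - x)" 1] by auto
      then have "1 \<le> ?u * ?v" using uv by simp
      moreover have "2 * (?u * ?v) \<le> ?u^2 + ?v^2"
        using sum_squares_bound[of ?u ?v] by simp
      moreover have "?u^2 = (1 + x) powr (q - 1)" "?v^2 = (1 - x) powr (q - 1)"
        by (simp_all add: power2_eq_square powr_add[symmetric] m_def)
      ultimately have "2 \<le> (1 + x) powr (q - 1) + (1 - x) powr (q - 1)" by linarith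
      then have "q * 2 \<le> q * ((1 + x) powr (q - 1) + (1 - x) powr (q - 1))"
        using assms by (intro mult_left_mono) auto
      then show ?thesis by (simp add: algebra_simps)
    qed
    ultimately show "\<exists>y. (?f has_real_derivative y) (at x) \<and> 0 \<le> y" by blast
  qed
  then show ?thesis by simp
qed

text \<open>The Taylor polynomial \<open>1 + p (p - 1) / 2 * b^2\<close> separates the two sides. It
  lies below the right-hand side because the derivative of the difference is controlled by
  \<open>powr_diff_ge\<close> with exponent \<open>p - 1\<close>, and above the left-hand side by
  Bernoulli's inequality for the exponent \<open>p / 2 \<le> 1\<close>.\<close>

lemma two_point_normalized:
  fixes b p :: real
  assumes b: "0 \<le> b" "b \<le> 1" and p: "1 < p" "p \<le> 2"
  shows "(1 + (p - 1) * b\<^sup>2) powr (p / 2) \<le> ((1 + b) powr p + (1 - b) powr p) / 2"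
proof -
  let ?f = "\<lambda>x. (1 + x) powr p + (1 - x) powr p - p * (p - 1) * x\<^sup>2"
  have "?f 0 \<le> ?f b"
  proof (rule DERIV_nonneg_imp_increasing_open[of 0 b ?f])
    show "0 \<le> b" by fact
    show "continuous_on {0..b} ?f"
      using assms by (intro continuous_on_diff continuous_on_add continuous_on_powr' continuous_on_mult
          continuous_on_const continuous_on_id continuous_on_power) auto
    fix x assume x: "0 < x" "x < b"
    have pos: "1 + x > 0" "1 - x > 0" using x assms by auto
    have "(?f has_real_derivative p * (1 + x) powr (p - 1) - p * (1 - x) powr (p - 1) - p * (p - 1) * 2 * x) (at x)"
      using pos by (auto intro!: derivative_eq_intros simp: field_simps)
    moreover have "0 \<le> p * ((1 + x) powr (p - 1) - (1 - x) powr (p - 1) - 2 * (p - 1) * x)"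
      using powr_diff_ge[of x "p - 1"] x assms by simp
    then have "0 \<le> p * (1 + x) powr (p - 1) - p * (1 - x) powr (p - 1) - p * (p - 1) * 2 * x"
      by (simp add: algebra_simps)
    ultimately show "\<exists>y. (?f has_real_derivative y) (at x) \<and> 0 \<le> y" by blast
  qed
  then have 1: "1 + p * (p - 1) / 2 * b\<^sup>2 \<le> ((1 + b) powr p + (1 - b) powr p) / 2" by simp
  have "(1 + (p - 1) * b\<^sup>2) powr (p / 2) * 1 powr (1 - p / 2)
      \<le> p / 2 * (1 + (p - 1) * b\<^sup>2) + (1 - p / 2) * 1"
    using p by (intro Youngs_inequality_0 add_pos_nonneg) auto
  also have "\<dots> = 1 + p * (p - 1) / 2 * b\<^sup>2" by (simp add: field_simps)
  finally show ?thesis using 1 by simp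
qed

text \<open>On the left stands the \<open>L^2\<close> norm of the function with values
  \<open>u\<close>, \<open>w\<close> on two points, its odd part damped by
  \<open>sqrt (p - 1)\<close>. Both sides are homogeneous, so division by the mean leads to the
  values \<open>1 + b\<close> and \<open>1 - b\<close>; nonnegativity of \<open>u\<close> and
  \<open>w\<close> keeps \<open>b\<close> in \<open>[0, 1]\<close>.\<close>

lemma two_point:
  fixes u w p :: real
  assumes "0 \<le> u" "0 \<le> w" and p: "1 < p" "p \<le> 2"
  shows "(((u + w) / 2)\<^sup>2 + (p - 1) * ((u - w) / 2)\<^sup>2) powr (1 / 2)
    \<le> ((u powr p + w powr p) / 2) powr (1 / p)"
  using assms(1,2)
proof (induction u w rule: linorder_wlog)
  case (sym a b)
  then show ?case by (simp add: add.commute power2_commute[of b a] power_divide)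
next
  case (le w u)
  show ?case
  proof (cases "u = 0")
    case True
    then show ?thesis using le by simp
  next
    case False
    define a where "a = (u + w) / 2"
    define b where "b = (u - w) / (u + w)"
    have a: "a > 0" using le False by (simp add: a_def)
    have b: "0 \<le> b" "b \<le> 1" using le False by (auto simp: b_def divide_simps)
    have u: "u = a * (1 + b)" and w: "w = a * (1 - b)"
      using le False by (auto simp: a_def b_def field_simps)
    have k: "0 < 1 + (p - 1) * b\<^sup>2" using p by (intro add_pos_nonneg) auto
    have "((u + w) / 2)\<^sup>2 + (p - 1) * ((u - w) / 2)\<^sup>2 = a\<^sup>2 * (1 + (p - 1) * b\<^sup>2)"
      unfolding u w by (simp add: field_simps power2_eq_square)
    then have "(((u + w) / 2)\<^sup>2 + (p - 1) * ((u - w) / 2)\<^sup>2) powr (1 / 2)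
        = a * (1 + (p - 1) * b\<^sup>2) powr (1 / 2)"
      using a k by (simp add: powr_mult powr_half_sqrt real_sqrt_mult)
    also have "(1 + (p - 1) * b\<^sup>2) powr (1 / 2) = ((1 + (p - 1) * b\<^sup>2) powr (p / 2)) powr (1 / p)"
      using p by (simp add: powr_powr)
    also have "\<dots> \<le> (((1 + b) powr p + (1 - b) powr p) / 2) powr (1 / p)"
      using p two_point_normalized[OF b p] by (intro powr_mono2) auto
    also have "a * \<dots> = (a powr p) powr (1 / p) * (((1 + b) powr p + (1 - b) powr p) / 2) powr (1 / p)"
      using a p by (simp add: powr_powr)
    also have "\<dots> = (a powr p * (((1 + b) powr p + (1 - b) powr p) / 2)) powr (1 / p)"
      by (subst powr_mult) auto
    also have "a powr p * (((1 + b) powr p + (1 - b) powr p) / 2) = (u powr p + w powr p) / 2"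
      unfolding u w using a b by (subst (1 2) powr_mult) (auto simp: algebra_simps)
    moreover have "((w - u) / 2)\<^sup>2 = ((u - w) / 2)\<^sup>2" by (simp add: power_divide power2_commute)
    ultimately show ?thesis using a by (simp add: add.commute mult_left_mono)
  qed
qed

text \<open>In terms of means \<open>a\<close>, \<open>c\<close> and half differences
  \<open>b\<close>, \<open>d\<close> the left side is \<open>a c + r b d\<close>. Cauchy--Schwarz is
  applied with the whole factor \<open>r\<close> attached to \<open>b\<close>: then
  \<open>c^2 + d^2\<close> is exactly the mean square of \<open>G\<close>, and the other factor is
  the one bounded by \<open>two_point\<close> with \<open>p - 1 = r^2\<close>.\<close>

lemma two_point_bilinear:
  fixes r :: real
  assumes r: "0 < r" "r \<le> 1" and nn: "0 \<le> F1" "0 \<le> F2" "0 \<le> G1" "0 \<le> G2"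
  shows "(1 + r) / 4 * (F1 * G1 + F2 * G2) + (1 - r) / 4 * (F1 * G2 + F2 * G1)
    \<le> ((F1 powr (1 + r\<^sup>2) + F2 powr (1 + r\<^sup>2)) / 2) powr (1 / (1 + r\<^sup>2)) * sqrt ((G1\<^sup>2 + G2\<^sup>2) / 2)"
proof -
  define a b c d where "a = (F1 + F2) / 2" "b = (F1 - F2) / 2" "c = (G1 + G2) / 2" "d = (G1 - G2) / 2"
  note D = this
  have "(1 + r) / 4 * (F1 * G1 + F2 * G2) + (1 - r) / 4 * (F1 * G2 + F2 * G1) = a * c + (r * b) * d"
    by (simp add: D field_simps)
  also have "\<dots> \<le> sqrt ((a\<^sup>2 + (r * b)\<^sup>2) * (c\<^sup>2 + d\<^sup>2))"
  proof (rule real_le_rsqrt)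
    have "0 \<le> (a * d - r * b * c)\<^sup>2" by simp
    then show "(a * c + r * b * d)\<^sup>2 \<le> (a\<^sup>2 + (r * b)\<^sup>2) * (c\<^sup>2 + d\<^sup>2)"
      by (simp add: power2_eq_square algebra_simps)
  qed
  also have "\<dots> = sqrt (a\<^sup>2 + r\<^sup>2 * b\<^sup>2) * sqrt ((G1\<^sup>2 + G2\<^sup>2) / 2)"
  proof -
    have "c\<^sup>2 + d\<^sup>2 = (G1\<^sup>2 + G2\<^sup>2) / 2" by (simp add: D field_simps power2_eq_square)
    then show ?thesis by (simp add: real_sqrt_mult power_mult_distrib)
  qed
  also have "sqrt (a\<^sup>2 + r\<^sup>2 * b\<^sup>2) \<le> ((F1 powr (1 + r\<^sup>2) + F2 powr (1 + r\<^sup>2)) / 2) powr (1 / (1 + r\<^sup>2))"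
    using two_point[of F1 F2 "1 + r\<^sup>2"] r nn by (simp add: D powr_half_sqrt power_le_one)
  finally show ?thesis by (simp add: mult_right_mono)
qed

text \<open>\<open>cube_avg r vs F (x, y)\<close> is the expectation of \<open>F (x + \<Sum> \<epsilon>\<^sub>i v\<^sub>i) (y + \<Sum> \<epsilon>'\<^sub>i v\<^sub>i)\<close>, where the
  pairs of signs \<open>(\<epsilon>\<^sub>i, \<epsilon>'\<^sub>i)\<close> are independent and have correlation \<open>r\<close>.\<close>

fun cube_avg :: "real \<Rightarrow> 'a::real_vector list \<Rightarrow> ('a \<times> 'a \<Rightarrow> real) \<Rightarrow> 'a \<times> 'a \<Rightarrow> real" where
  "cube_avg r [] F z = F z"
| "cube_avg r (v # vs) F z =
     (1 + r) / 4 * (cube_avg r vs F (z + (v, v)) + cube_avg r vs F (z + (- v, - v)))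
     + (1 - r) / 4 * (cube_avg r vs F (z + (v, - v)) + cube_avg r vs F (z + (- v, v)))"

lemma cube_avg_add: "cube_avg r vs (\<lambda>z. F z + G z) z = cube_avg r vs F z + cube_avg r vs G z"
  by (induction vs arbitrary: z) (simp_all add: algebra_simps)

lemma cube_avg_cmult: "cube_avg r vs (\<lambda>z. c * F z) z = c * cube_avg r vs F z"
  by (induction vs arbitrary: z) (simp_all add: algebra_simps)

text \<open>The four weights are nonnegative and sum to 1 at each level. Uniform approximation
  errors are therefore not amplified by the number of steps.\<close>

lemma cube_avg_abs_le:
  assumes r: "0 \<le> r" "r \<le> 1" and F: "\<And>z. \<bar>F z\<bar> \<le> e"
  shows "\<bar>cube_avg r vs F z\<bar> \<le> e"
proof (induction vs arbitrary: z)
  case (Cons v vs)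
  let ?c = "\<lambda>w. cube_avg r vs F (z + w)"
  have "\<bar>(1 + r) / 4 * (?c (v, v) + ?c (- v, - v)) + (1 - r) / 4 * (?c (v, - v) + ?c (- v, v))\<bar>
     \<le> (1 + r) / 4 * (\<bar>?c (v, v)\<bar> + \<bar>?c (- v, - v)\<bar>) + (1 - r) / 4 * (\<bar>?c (v, - v)\<bar> + \<bar>?c (- v, v)\<bar>)"
    using r by (intro order_trans[OF abs_triangle_ineq] add_mono) (auto simp: abs_mult intro!: mult_left_mono)
  also have "\<dots> \<le> (1 + r) / 4 * (e + e) + (1 - r) / 4 * (e + e)"
    using r Cons by (intro add_mono mult_left_mono) auto
  also have "\<dots> = e" by (simp add: field_simps)
  finally show ?case by simp
qed (use F in auto)

lemma cube_avg_diff: "cube_avg r vs (\<lambda>z. F z - G z) z = cube_avg r vs F z - cube_avg r vs G z"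
  using cube_avg_add[of r vs F "\<lambda>z. (-1) * G z" z] by (simp only: cube_avg_cmult) simp

text \<open>The second starting point is a dummy here. This lets the induction below bound the four
  shifted averages by products of a function of \<open>x\<close> and a function of
  \<open>y\<close>.\<close>

lemma cube_avg_fst_indep: "cube_avg r vs (\<lambda>z. F (fst z)) (x, y) = cube_avg r vs (\<lambda>z. F (fst z)) (x, y')"
proof (induction vs arbitrary: x y y')
  case (Cons v vs)
  show ?case
    unfolding cube_avg.simps add_Pair
    by (simp only: Cons[of "x + v" "y + v" "y' + v"] Cons[of "x + v" "y + - v" "y' + - v"]
        Cons[of "x + - v" "y + v" "y' + v"] Cons[of "x + - v" "y + - v" "y' + - v"])
qed simp

text \<open>Each sign alone is uniform, since \<open>(1 + r) / 4 + (1 - r) / 4 = 1 / 2\<close>; the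
  correlation disappears from the marginal.\<close>

lemma cube_avg_fst_Cons:
  "cube_avg r (v # vs) (\<lambda>z. F (fst z)) (x, y)
    = (cube_avg r vs (\<lambda>z. F (fst z)) (x + v, y) + cube_avg r vs (\<lambda>z. F (fst z)) (x - v, y)) / 2"
  using cube_avg_fst_indep[of r vs F "x + v" "y + v" y] cube_avg_fst_indep[of r vs F "x + v" "y - v" y]
    cube_avg_fst_indep[of r vs F "x - v" "y + v" y] cube_avg_fst_indep[of r vs F "x - v" "y - v" y]
  by (simp add: field_simps)

lemma cube_avg_snd_indep: "cube_avg r vs (\<lambda>z. F (snd z)) (x, y) = cube_avg r vs (\<lambda>z. F (snd z)) (x', y)"
proof (induction vs arbitrary: x y x')
  case (Cons v vs)
  show ?case
    unfolding cube_avg.simps add_Pair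
    by (simp only: Cons[of "x + v" "y + v" "x' + v"] Cons[of "x + v" "y + - v" "x' + v"]
        Cons[of "x + - v" "y + v" "x' + - v"] Cons[of "x + - v" "y + - v" "x' + - v"])
qed simp

lemma cube_avg_snd_Cons:
  "cube_avg r (v # vs) (\<lambda>z. F (snd z)) (x, y)
    = (cube_avg r vs (\<lambda>z. F (snd z)) (x, y + v) + cube_avg r vs (\<lambda>z. F (snd z)) (x, y - v)) / 2"
  using cube_avg_snd_indep[of r vs F "x + v" "y + v" x] cube_avg_snd_indep[of r vs F "x + v" "y - v" x]
    cube_avg_snd_indep[of r vs F "x - v" "y + v" x] cube_avg_snd_indep[of r vs F "x - v" "y - v" x]
  by (simp add: field_simps)

lemma cube_avg_nonneg:
  assumes "0 \<le> r" "r \<le> 1" "\<And>z. 0 \<le> F z"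
  shows "0 \<le> cube_avg r vs F z"
  using assms by (induction vs arbitrary: z) auto

text \<open>The two-point inequality tensorizes without Minkowski's inequality in its bilinear form.\<close>

lemma hypercube_hypercontractive:
  fixes f g :: "'a::real_vector \<Rightarrow> real"
  assumes r: "0 < r" "r \<le> 1"
  shows "\<bar>cube_avg r vs (\<lambda>z. f (fst z) * g (snd z)) (x, y)\<bar>
    \<le> cube_avg r vs (\<lambda>z. \<bar>f (fst z)\<bar> powr (1 + r\<^sup>2)) (x, y) powr (1 / (1 + r\<^sup>2))
      * sqrt (cube_avg r vs (\<lambda>z. (g (snd z))\<^sup>2) (x, y))"
proof (induction vs arbitrary: x y)
  case Nil
  have "1 + r\<^sup>2 \<noteq> 0" by (metis add_pos_nonneg less_numeral_extra(1) zero_le_power2 less_irrefl)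
  then show ?case by (simp add: powr_powr abs_mult)
next
  case (Cons v vs)
  let ?p = "1 + r\<^sup>2"
  \<comment> \<open>\<open>F\<close> and \<open>G\<close> are the norms over the remaining signs as
    functions of the starting point. The induction hypothesis at the four shifted points reduces the
    claim to the two-point inequality for the values of \<open>F\<close> at \<open>x + v\<close>,
    \<open>x - v\<close> and of \<open>G\<close> at \<open>y + v\<close>,
    \<open>y - v\<close>.\<close>
  define F where "F x = cube_avg r vs (\<lambda>z. \<bar>f (fst z)\<bar> powr ?p) (x, y) powr (1 / ?p)" for x
  define G where "G y = sqrt (cube_avg r vs (\<lambda>z. (g (snd z))\<^sup>2) (x, y))" for y
  let ?c = "\<lambda>x y. cube_avg r vs (\<lambda>z. f (fst z) * g (snd z)) (x, y)"
  have nz: "?p \<noteq> 0" by (metis add_pos_nonneg less_numeral_extra(1) zero_le_power2 less_irrefl)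
  have IH: "\<bar>?c x' y'\<bar> \<le> F x' * G y'" for x' y'
    using Cons[of x' y'] unfolding F_def G_def
      cube_avg_fst_indep[of r vs "\<lambda>x. \<bar>f x\<bar> powr ?p" x' y' y]
      cube_avg_snd_indep[of r vs "\<lambda>y. (g y)\<^sup>2" x' y' x] .
  have Fp: "F x' powr ?p = cube_avg r vs (\<lambda>z. \<bar>f (fst z)\<bar> powr ?p) (x', y)" for x'
    using r nz by (simp add: F_def powr_powr cube_avg_nonneg)
  have G2: "(G y')\<^sup>2 = cube_avg r vs (\<lambda>z. (g (snd z))\<^sup>2) (x, y')" for y'
    using r by (simp add: G_def cube_avg_nonneg)
  have "\<bar>cube_avg r (v # vs) (\<lambda>z. f (fst z) * g (snd z)) (x, y)\<bar>
    \<le> (1 + r) / 4 * (\<bar>?c (x + v) (y + v)\<bar> + \<bar>?c (x - v) (y - v)\<bar>)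
      + (1 - r) / 4 * (\<bar>?c (x + v) (y - v)\<bar> + \<bar>?c (x - v) (y + v)\<bar>)"
    unfolding cube_avg.simps using r
    by (intro order_trans[OF abs_triangle_ineq] add_mono) (auto simp: abs_mult intro!: mult_left_mono)
  also have "\<dots> \<le> (1 + r) / 4 * (F (x + v) * G (y + v) + F (x - v) * G (y - v))
      + (1 - r) / 4 * (F (x + v) * G (y - v) + F (x - v) * G (y + v))"
    using r by (intro add_mono mult_left_mono IH) auto
  also have "\<dots> \<le> ((F (x + v) powr ?p + F (x - v) powr ?p) / 2) powr (1 / ?p)
      * sqrt (((G (y + v))\<^sup>2 + (G (y - v))\<^sup>2) / 2)"
    using r by (intro two_point_bilinear) (auto simp: F_def G_def cube_avg_nonneg)
  also have "(F (x + v) powr ?p + F (x - v) powr ?p) / 2 = cube_avg r (v # vs) (\<lambda>z. \<bar>f (fst z)\<bar> powr ?p) (x, y)"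
    unfolding Fp by (rule cube_avg_fst_Cons[where F = "\<lambda>x. \<bar>f x\<bar> powr ?p", symmetric])
  also have "((G (y + v))\<^sup>2 + (G (y - v))\<^sup>2) / 2 = cube_avg r (v # vs) (\<lambda>z. (g (snd z))\<^sup>2) (x, y)"
    unfolding G2 by (rule cube_avg_snd_Cons[where F = "\<lambda>y. (g y)\<^sup>2", symmetric])
  finally show ?case .
qed

text \<open>Equal signs shift the phase by plus or minus \<open>(l + m) \<bullet> v\<close>,
  opposite signs by plus or minus \<open>(l - m) \<bullet> v\<close>. In each symmetric pair the
  sine terms cancel, so a cosine is an eigenfunction of every averaging step.\<close>

lemma cube_avg_cos:
  fixes l m :: "'a::real_inner"
  shows "cube_avg r vs (\<lambda>z. cos ((l, m) \<bullet> z + a)) z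
    = cos ((l, m) \<bullet> z + a) * (\<Prod>v\<leftarrow>vs. (1 + r) / 2 * cos ((l + m) \<bullet> v) + (1 - r) / 2 * cos ((l - m) \<bullet> v))"
proof (induction vs arbitrary: z)
  case (Cons v vs)
  let ?t = "(l, m) \<bullet> z + a"
  have e: "(l, m) \<bullet> (z + (v, v)) + a = ?t + (l + m) \<bullet> v" "(l, m) \<bullet> (z + (- v, - v)) + a = ?t - (l + m) \<bullet> v"
    "(l, m) \<bullet> (z + (v, - v)) + a = ?t + (l - m) \<bullet> v" "(l, m) \<bullet> (z + (- v, v)) + a = ?t - (l - m) \<bullet> v"
    by (auto simp: inner_add_right inner_Pair inner_add_left inner_diff_left algebra_simps)
  have step: "(1 + r) / 4 * (cos (T + A) * P + cos (T - A) * P) + (1 - r) / 4 * (cos (T + B) * P + cos (T - B) * P)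
      = cos T * (((1 + r) / 2 * cos A + (1 - r) / 2 * cos B) * P)" for T A B P :: real
    by (simp add: cos_add cos_diff field_simps)
  show ?case unfolding cube_avg.simps Cons e list.map prod_list.Cons by (rule step)
qed simp

section \<open>Gaussian measure and Mehler kernel\<close>

lemma integral_lborel_prod:
  fixes f :: "'a::euclidean_space \<Rightarrow> real \<Rightarrow> complex"
  assumes f: "\<And>b. b \<in> Basis \<Longrightarrow> integrable lborel (f b)"
  shows "(\<integral>x. (\<Prod>b\<in>Basis. f b (x \<bullet> b)) \<partial>lborel) = (\<Prod>b\<in>Basis. (\<integral>x. f b x \<partial>lborel))"
proof -
  have [measurable]: "f b \<in> borel_measurable borel" if "b \<in> Basis" for b
    using borel_measurable_integrable[OF f[OF that]] by simp
  interpret product_sigma_finite "\<lambda>_::'a. lborel :: real measure" ..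
  show ?thesis
    by (subst lborel_eq, subst integral_distr) (simp_all add: product_integral_prod[OF finite_Basis f])
qed

text \<open>The exponent lacks the usual factor 1/2, so each coordinate has variance 1/2. This is
  the origin of the \<open>1 / 4\<close> in the Fourier transform and of the step length
  \<open>1 / sqrt (2 N)\<close> of the random walk.\<close>

lemma gauss_eq_prod:
  "(gauss :: (real ^ 'n) measure)
    = density lborel (\<lambda>x. ennreal (\<Prod>b\<in>Basis. normal_density 0 (1 / sqrt 2) (x \<bullet> b)))"
proof -
  have "pi powr (- real CARD('n) / 2) * exp (- (norm x)\<^sup>2) = (\<Prod>b\<in>Basis. normal_density 0 (1 / sqrt 2) (x \<bullet> b))"
    for x :: "real ^ 'n"
  proof -
    have "(\<Prod>b\<in>Basis. normal_density 0 (1 / sqrt 2) (x \<bullet> b)) = (\<Prod>b\<in>(Basis :: (real ^ 'n) set). pi powr (- 1 / 2) * exp (- (x \<bullet> b)\<^sup>2))"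
      by (simp add: normal_density_def power_divide powr_minus powr_half_sqrt field_simps)
    also have "\<dots> = (pi powr (- 1 / 2)) ^ CARD('n) * exp (- (norm x)\<^sup>2)"
      by (simp add: prod.distrib exp_sum[symmetric] sum_negf power2_norm_eq_inner power2_eq_square[of "x \<bullet> _"] euclidean_inner[of x x, symmetric])
    also have "(pi powr (- 1 / 2)) ^ CARD('n) = pi powr (- real CARD('n) / 2)"
      by (simp add: powr_realpow[symmetric] powr_powr)
    finally show ?thesis by simp
  qed
  then show ?thesis unfolding gauss_def by simp
qed

lemma sets_gauss [measurable_cong, simp]: "sets gauss = sets borel"
  by (simp add: gauss_def)

lemma space_gauss [simp]: "space gauss = UNIV"
  by (simp add: gauss_def)

lemma prob_space_gauss: "prob_space (gauss :: (real ^ 'n) measure)"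
proof
  have "emeasure (gauss :: (real ^ 'n) measure) UNIV
    = (\<integral>\<^sup>+ x. (\<Prod>b\<in>(Basis :: (real ^ 'n) set). ennreal (normal_density 0 (1 / sqrt 2) (x \<bullet> b))) \<partial>lborel)"
    by (subst gauss_eq_prod, subst emeasure_density) (auto simp: prod_ennreal)
  also have "\<dots> = (\<Prod>b\<in>(Basis :: (real ^ 'n) set). (\<integral>\<^sup>+ x. ennreal (normal_density 0 (1 / sqrt 2) x) \<partial>lborel))"
    by (subst nn_integral_lborel_prod) auto
  also have "\<dots> = 1"
    by (intro prod.neutral ballI) (simp add: nn_integral_eq_integral)
  finally show "emeasure (gauss :: (real ^ 'n) measure) (space gauss) = 1" by simp
qed

lemma normal_density_half_fourier:
  "(\<integral>x. normal_density 0 (1 / sqrt 2) x *\<^sub>R iexp (s * x) \<partial>lborel) = complex_of_real (exp (- (s\<^sup>2) / 4))"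
proof -
  let ?s = "s / sqrt 2"
  have "complex_of_real (exp (- (?s\<^sup>2) / 2)) = char std_normal_distribution ?s"
    by (simp add: char_std_normal_distribution)
  also have "\<dots> = (\<integral>x. std_normal_density x *\<^sub>R iexp (?s * x) \<partial>lborel)"
    unfolding char_def by (subst integral_density) auto
  also have "\<dots> = sqrt 2 *\<^sub>R (\<integral>x. std_normal_density (sqrt 2 * x) *\<^sub>R iexp (?s * (sqrt 2 * x)) \<partial>lborel)"
    by (subst lborel_integral_real_affine[where c="sqrt 2" and t=0]) simp_all
  also have "\<dots> = (\<integral>x. sqrt 2 *\<^sub>R (std_normal_density (sqrt 2 * x) *\<^sub>R iexp (?s * (sqrt 2 * x))) \<partial>lborel)"
    by (rule integral_scaleR_right[symmetric])
  also have "\<dots> = (\<integral>x. normal_density 0 (1 / sqrt 2) x *\<^sub>R iexp (s * x) \<partial>lborel)"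
    by (intro Bochner_Integration.integral_cong refl)
      (simp add: normal_density_def power_mult_distrib power_divide real_sqrt_mult scaleR_conv_of_real)
  finally show ?thesis by (simp add: power_divide)
qed

lemma gauss_fourier:
  fixes l :: "real ^ 'n"
  shows "(\<integral>x. iexp (l \<bullet> x) \<partial>gauss) = complex_of_real (exp (- ((norm l)\<^sup>2) / 4))"
proof -
  have "(\<integral>x. iexp (l \<bullet> x) \<partial>gauss)
      = (\<integral>x. (\<Prod>b\<in>Basis. normal_density 0 (1 / sqrt 2) (x \<bullet> b)) *\<^sub>R iexp (l \<bullet> x) \<partial>lborel)"
    unfolding gauss_eq_prod by (subst integral_density) (auto intro!: AE_I2 prod_nonneg)
  also have "\<dots> = (\<integral>x. (\<Prod>b\<in>Basis. normal_density 0 (1 / sqrt 2) (x \<bullet> b) *\<^sub>R iexp ((l \<bullet> b) * (x \<bullet> b))) \<partial>lborel)"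
  proof (intro Bochner_Integration.integral_cong refl)
    fix x
    have "iexp (l \<bullet> x) = iexp (\<Sum>b\<in>Basis. (l \<bullet> b) * (x \<bullet> b))"
      by (subst euclidean_inner) (rule refl)
    also have "\<dots> = (\<Prod>b\<in>Basis. iexp ((l \<bullet> b) * (x \<bullet> b)))"
      by (simp only: of_real_sum sum_distrib_left exp_sum finite_Basis)
    finally have e: "iexp (l \<bullet> x) = (\<Prod>b\<in>Basis. iexp ((l \<bullet> b) * (x \<bullet> b)))" .
    show "(\<Prod>b\<in>Basis. normal_density 0 (1 / sqrt 2) (x \<bullet> b)) *\<^sub>R iexp (l \<bullet> x)
      = (\<Prod>b\<in>Basis. normal_density 0 (1 / sqrt 2) (x \<bullet> b) *\<^sub>R iexp ((l \<bullet> b) * (x \<bullet> b)))"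
      unfolding e scaleR_conv_of_real of_real_prod prod.distrib ..
  qed
  also have "\<dots> = (\<Prod>b\<in>Basis. (\<integral>x. normal_density 0 (1 / sqrt 2) x *\<^sub>R iexp ((l \<bullet> b) * x) \<partial>lborel))"
  proof (rule integral_lborel_prod)
    fix b :: "real ^ 'n"
    have "integrable lborel (\<lambda>x. normal_density 0 (1 / sqrt 2) x)" by simp
    then show "integrable lborel (\<lambda>x. normal_density 0 (1 / sqrt 2) x *\<^sub>R iexp ((l \<bullet> b) * x))"
      by (rule Bochner_Integration.integrable_bound) (auto simp: normal_density_nonneg)
  qed
  also have "\<dots> = complex_of_real (exp (- ((norm l)\<^sup>2) / 4))"
  proof -
    have "(norm l)\<^sup>2 = (\<Sum>b\<in>Basis. (l \<bullet> b)\<^sup>2)"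
      unfolding power2_norm_eq_inner by (subst euclidean_inner) (simp add: power2_eq_square)
    then have "- ((norm l)\<^sup>2) / 4 = (\<Sum>b\<in>Basis. - ((l \<bullet> b)\<^sup>2) / 4)"
      by (simp add: sum_negf sum_divide_distrib)
    then show ?thesis
      unfolding normal_density_half_fourier by (simp only: exp_sum finite_Basis of_real_prod)
  qed
  finally show ?thesis .
qed

text \<open>Completing the square: the exponents of the kernel and of the Gaussian weight at
  \<open>y\<close> add up to \<open>- |y - r x|^2 / (1 - r^2)\<close>, which is
  \<open>- |z|^2\<close>. The power of \<open>\<rho>\<close> is the Jacobian of
  \<open>z \<mapsto> y\<close> and cancels the prefactor of the kernel.\<close>

lemma mehler_kernel_density:
  fixes x z :: "real ^ 'n"
  assumes t: "t > 0"
  defines "r \<equiv> exp (- t)"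
  defines "\<rho> \<equiv> sqrt (1 - r\<^sup>2)"
  defines "y \<equiv> r *\<^sub>R x + \<rho> *\<^sub>R z"
  shows "\<rho> ^ CARD('n) * (mehler_kernel t x y * (pi powr (- real CARD('n) / 2) * exp (- (norm y)\<^sup>2)))
    = pi powr (- real CARD('n) / 2) * exp (- (norm z)\<^sup>2)"
proof -
  have r: "0 < r" "r < 1" using t by (auto simp: r_def)
  have r2: "exp (- 2 * t) = r\<^sup>2" by (simp add: r_def power2_eq_square exp_add[symmetric])
  have rr: "r\<^sup>2 < 1" using r by (simp add: power_less_one_iff)
  then have rho: "\<rho> > 0" "\<rho>\<^sup>2 = 1 - r\<^sup>2" by (auto simp: \<rho>_def)
  have c: "(1 - r\<^sup>2) powr (real CARD('n) / 2) = \<rho> ^ CARD('n)"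
    unfolding rho(2)[symmetric] powr_numeral[OF less_imp_le[OF rho(1)], symmetric] powr_powr
    using rho(1) by (simp add: powr_realpow)
  have "- r\<^sup>2 * (norm (x - y))\<^sup>2 / \<rho>\<^sup>2 + 2 * r * (x \<bullet> y) / (1 + r) - (norm y)\<^sup>2 = - (norm z)\<^sup>2"
  proof -
    define X S Z where "X = x \<bullet> x" "S = x \<bullet> z" "Z = z \<bullet> z"
    have 1: "(norm (x - y))\<^sup>2 = (1 - r)\<^sup>2 * X - 2 * (1 - r) * \<rho> * S + \<rho>\<^sup>2 * Z"
      unfolding power2_norm_eq_inner y_def X_S_Z_def
      by (simp add: inner_diff_left inner_diff_right inner_add_left inner_add_right inner_commute[of z x] power2_eq_square algebra_simps)
    have 2: "(norm y)\<^sup>2 = r\<^sup>2 * X + 2 * r * \<rho> * S + \<rho>\<^sup>2 * Z"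
      unfolding power2_norm_eq_inner y_def X_S_Z_def
      by (simp add: inner_add_left inner_add_right inner_commute[of z x] power2_eq_square algebra_simps)
    have 3: "x \<bullet> y = r * X + \<rho> * S"
      by (simp add: y_def X_S_Z_def inner_add_right)
    have f: "1 - r\<^sup>2 = (1 - r) * (1 + r)" by (simp add: power2_eq_square algebra_simps)
    have ne: "1 - r \<noteq> 0" "1 + r \<noteq> 0" using r by auto
    have 4: "(norm z)\<^sup>2 = Z" by (simp add: X_S_Z_def power2_norm_eq_inner)
    show ?thesis unfolding 1 2 3 4 unfolding rho(2) f using ne
      by (simp add: divide_simps) (simp add: power2_eq_square algebra_simps)
  qed
  then have e: "exp (- r\<^sup>2 * (norm (x - y))\<^sup>2 / (1 - r\<^sup>2)) * exp (2 * r * (x \<bullet> y) / (1 + r)) * exp (- (norm y)\<^sup>2) = exp (- (norm z)\<^sup>2)"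
    by (simp add: exp_add[symmetric] rho(2))
  have "\<rho> ^ CARD('n) * (mehler_kernel t x y * (pi powr (- real CARD('n) / 2) * exp (- (norm y)\<^sup>2)))
    = (\<rho> ^ CARD('n) / \<rho> ^ CARD('n)) * pi powr (- real CARD('n) / 2)
      * (exp (- r\<^sup>2 * (norm (x - y))\<^sup>2 / (1 - r\<^sup>2)) * exp (2 * r * (x \<bullet> y) / (1 + r)) * exp (- (norm y)\<^sup>2))"
    unfolding mehler_kernel_def r2 c r_def[symmetric] by (simp add: mult_ac)
  then show ?thesis unfolding e using rho by simp
qed

lemma mehler_kernel_nonneg: "0 \<le> mehler_kernel t x y"
  by (simp add: mehler_kernel_def)

lemma mehler_kernel_commute: "mehler_kernel t x y = mehler_kernel t y x"
  by (simp add: mehler_kernel_def norm_minus_commute inner_commute)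

lemma borel_measurable_mehler_kernel [measurable (raw)]:
  assumes [measurable]: "f \<in> borel_measurable M" "g \<in> borel_measurable M"
  shows "(\<lambda>w. mehler_kernel t (f w) (g w)) \<in> borel_measurable M"
  unfolding mehler_kernel_def by measurable

lemma nn_integral_lborel_affine:
  fixes f :: "'a::euclidean_space \<Rightarrow> ennreal"
  assumes c: "c \<noteq> 0" and [measurable]: "f \<in> borel_measurable borel"
  shows "(\<integral>\<^sup>+ x. f x \<partial>lborel) = (\<integral>\<^sup>+ x. ennreal (\<bar>c\<bar> ^ DIM('a)) * f (t + c *\<^sub>R x) \<partial>lborel)"
  by (subst lborel_affine[OF c, of t], subst nn_integral_density, simp, simp, subst nn_integral_distr) auto

text \<open>The substitution \<open>y = r x + \<rho> z\<close> gives the kernel its probabilistic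
  meaning: it describes a Gaussian step starting at \<open>r x\<close>. In particular its total mass
  is 1.\<close>

lemma density_mehler_kernel:
  fixes x :: "real ^ 'n"
  assumes t: "t > 0"
  shows "density gauss (\<lambda>y. ennreal (mehler_kernel t x y))
    = distr gauss borel (\<lambda>z. exp (- t) *\<^sub>R x + sqrt (1 - (exp (- t))\<^sup>2) *\<^sub>R z)"
proof (rule measure_eqI)
  let ?r = "exp (- t)"
  let ?\<rho> = "sqrt (1 - ?r\<^sup>2)"
  let ?T = "\<lambda>z. ?r *\<^sub>R x + ?\<rho> *\<^sub>R z"
  let ?h = "\<lambda>x::real ^ 'n. pi powr (- real CARD('n) / 2) * exp (- (norm x)\<^sup>2)"
  have rho: "?\<rho> > 0" using t by (simp add: power_less_one_iff)
  fix A assume "A \<in> sets (density gauss (\<lambda>y. ennreal (mehler_kernel t x y)))"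
  then have [measurable]: "A \<in> sets borel" by simp
  have "emeasure (density gauss (\<lambda>y. ennreal (mehler_kernel t x y))) A
     = (\<integral>\<^sup>+ y. ennreal (mehler_kernel t x y) * indicator A y \<partial>gauss)"
    by (subst emeasure_density) auto
  also have "\<dots> = (\<integral>\<^sup>+ y. ennreal (?h y) * (ennreal (mehler_kernel t x y) * indicator A y) \<partial>lborel)"
    unfolding gauss_def by (subst nn_integral_density) auto
  also have "\<dots> = (\<integral>\<^sup>+ z. ennreal (\<bar>?\<rho>\<bar> ^ CARD('n)) * (ennreal (?h (?T z)) * (ennreal (mehler_kernel t x (?T z)) * indicator A (?T z))) \<partial>lborel)"
    using rho by (subst nn_integral_lborel_affine[of ?\<rho> _ "?r *\<^sub>R x"]) simp_all
  also have "\<dots> = (\<integral>\<^sup>+ z. ennreal (?h z) * indicator A (?T z) \<partial>lborel)"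
  proof (rule nn_integral_cong)
    fix z :: "real ^ 'n"
    have "ennreal (\<bar>?\<rho>\<bar> ^ CARD('n)) * (ennreal (?h (?T z)) * ennreal (mehler_kernel t x (?T z))) = ennreal (?h z)"
      using mehler_kernel_density[OF t, of x z] rho
      by (simp add: ennreal_mult[symmetric] mehler_kernel_nonneg mult_ac)
    then show "ennreal (\<bar>?\<rho>\<bar> ^ CARD('n)) * (ennreal (?h (?T z)) * (ennreal (mehler_kernel t x (?T z)) * indicator A (?T z)))
      = ennreal (?h z) * indicator A (?T z)"
      by (metis (no_types, lifting) mult.assoc)
  qed
  also have "\<dots> = (\<integral>\<^sup>+ z. indicator A (?T z) \<partial>gauss)"
    unfolding gauss_def by (subst nn_integral_density) auto
  also have "\<dots> = (\<integral>\<^sup>+ z. indicator A z \<partial>distr gauss borel ?T)"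
    by (subst nn_integral_distr) auto
  also have "\<dots> = emeasure (distr gauss borel ?T) A" by simp
  finally show "emeasure (density gauss (\<lambda>y. ennreal (mehler_kernel t x y))) A = emeasure (distr gauss borel ?T) A" .
qed simp

text \<open>The law of a pair \<open>(y, x)\<close> of Gaussian vectors with correlation \<open>r\<close>; the Mehler kernel with
  \<open>r = exp (- t)\<close> is its density with respect to the product of the marginals.\<close>

definition mehler_joint :: "real \<Rightarrow> ((real ^ 'n) \<times> (real ^ 'n)) measure" where
  "mehler_joint r = distr (gauss \<Otimes>\<^sub>M gauss) borel (\<lambda>(x, z). (r *\<^sub>R x + sqrt (1 - r\<^sup>2) *\<^sub>R z, x))"

lemma sets_mehler_joint [measurable_cong, simp]: "sets (mehler_joint r) = sets borel"
  by (simp add: mehler_joint_def)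

lemma space_mehler_joint [simp]: "space (mehler_joint r) = UNIV"
  by (simp add: mehler_joint_def)

lemma borel_measurable_fst_snd [measurable]:
  "(fst :: 'a::second_countable_topology \<times> 'b::second_countable_topology \<Rightarrow> 'a) \<in> borel_measurable borel"
  "(snd :: 'a \<times> 'b \<Rightarrow> 'b) \<in> borel_measurable borel"
  unfolding borel_prod[symmetric] by measurable

lemma pair_prob_space_gauss: "pair_prob_space (gauss :: (real ^ 'n) measure) (gauss :: (real ^ 'n) measure)"
  using prob_space_gauss by (metis pair_prob_space_def pair_sigma_finite_def prob_space_imp_sigma_finite)

lemma measurable_mehler_map [measurable]:
  "(\<lambda>(x, z). (r *\<^sub>R x + s *\<^sub>R z, x)) \<in> (gauss :: (real ^ 'n) measure) \<Otimes>\<^sub>M gauss \<rightarrow>\<^sub>M borel"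
  unfolding borel_prod[symmetric] split_def by measurable

lemma prob_space_mehler_joint: "prob_space (mehler_joint r :: ((real ^ 'n) \<times> (real ^ 'n)) measure)"
proof -
  interpret pair_prob_space "gauss :: (real ^ 'n) measure" "gauss :: (real ^ 'n) measure"
    by (rule pair_prob_space_gauss)
  show ?thesis unfolding mehler_joint_def by (rule P.prob_space_distr) measurable
qed

lemma integral_mehler_joint:
  fixes F :: "(real ^ 'n) \<times> (real ^ 'n) \<Rightarrow> 'b::{banach, second_countable_topology}"
  assumes [measurable]: "F \<in> borel_measurable borel" and F: "\<And>w. norm (F w) \<le> B"
  shows "integral\<^sup>L (mehler_joint r) F
    = (\<integral>x. (\<integral>z. F (r *\<^sub>R x + sqrt (1 - r\<^sup>2) *\<^sub>R z, x) \<partial>gauss) \<partial>gauss)"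
proof -
  interpret pair_prob_space "gauss :: (real ^ 'n) measure" "gauss :: (real ^ 'n) measure"
    by (rule pair_prob_space_gauss)
  have "integrable (gauss \<Otimes>\<^sub>M gauss) (\<lambda>w. F (case w of (x, z) \<Rightarrow> (r *\<^sub>R x + sqrt (1 - r\<^sup>2) *\<^sub>R z, x)))"
    by (rule P.integrable_const_bound[where B=B]) (auto intro!: AE_I2 F simp: split_def)
  then show ?thesis
    unfolding mehler_joint_def
    by (subst integral_distr) (auto simp: integral_fst'[symmetric] split_def)
qed

text \<open>The phase is \<open>(r l + m) \<bullet> x\<close> plus a multiple of
  \<open>l \<bullet> z\<close> with independent \<open>x\<close> and \<open>z\<close>, so two
  Gaussian Fourier transforms are multiplied. The terms \<open>r^2 |l|^2\<close> and
  \<open>(1 - r^2) |l|^2\<close> recombine to \<open>|l|^2\<close>.\<close>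

lemma iexp_mehler_joint:
  fixes l m :: "real ^ 'n"
  assumes r: "0 \<le> r" "r \<le> 1"
  shows "(\<integral>w. iexp ((l, m) \<bullet> w) \<partial>mehler_joint r)
    = complex_of_real (exp (- ((norm l)\<^sup>2 + (norm m)\<^sup>2 + 2 * r * (l \<bullet> m)) / 4))"
proof -
  let ?s = "sqrt (1 - r\<^sup>2)"
  have s: "?s\<^sup>2 = 1 - r\<^sup>2" using r by (simp add: power_le_one)
  have "(\<integral>w. iexp ((l, m) \<bullet> w) \<partial>mehler_joint r)
    = (\<integral>x. (\<integral>z. iexp ((l, m) \<bullet> (r *\<^sub>R x + ?s *\<^sub>R z, x)) \<partial>gauss) \<partial>gauss)"
    by (rule integral_mehler_joint[where B=1]) auto
  also have "\<dots> = (\<integral>x. (\<integral>z. iexp ((r *\<^sub>R l + m) \<bullet> x) * iexp ((?s *\<^sub>R l) \<bullet> z) \<partial>gauss) \<partial>gauss)"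
    by (intro Bochner_Integration.integral_cong refl)
      (simp add: inner_add_left inner_add_right exp_add[symmetric] algebra_simps)
  also have "\<dots> = complex_of_real (exp (- ((norm (r *\<^sub>R l + m))\<^sup>2) / 4)) * complex_of_real (exp (- ((norm (?s *\<^sub>R l))\<^sup>2) / 4))"
    by (simp only: integral_mult_right_zero integral_mult_left_zero gauss_fourier)
  also have "\<dots> = complex_of_real (exp (- ((norm (r *\<^sub>R l + m))\<^sup>2) / 4 + - ((norm (?s *\<^sub>R l))\<^sup>2) / 4))"
    by (simp only: exp_add of_real_mult)
  also have "- ((norm (r *\<^sub>R l + m))\<^sup>2) / 4 + - ((norm (?s *\<^sub>R l))\<^sup>2) / 4
      = - ((norm l)\<^sup>2 + (norm m)\<^sup>2 + 2 * r * (l \<bullet> m)) / 4"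
  proof -
    have "(norm (?s *\<^sub>R l))\<^sup>2 = ?s\<^sup>2 * (norm l)\<^sup>2" by (simp only: norm_scaleR power_mult_distrib power2_abs)
    moreover have "(norm (r *\<^sub>R l + m))\<^sup>2 = r\<^sup>2 * (norm l)\<^sup>2 + 2 * r * (l \<bullet> m) + (norm m)\<^sup>2"
      unfolding power2_norm_eq_inner
      by (simp add: inner_add_left inner_add_right inner_commute[of m l] power2_eq_square algebra_simps)
    ultimately show ?thesis unfolding s by (simp add: field_simps)
  qed
  finally show ?thesis .
qed

lemma cos_mehler_joint:
  fixes l m :: "real ^ 'n"
  assumes r: "0 \<le> r" "r \<le> 1"
  shows "(\<integral>w. cos ((l, m) \<bullet> w + a) \<partial>mehler_joint r)
    = cos a * exp (- ((norm l)\<^sup>2 + (norm m)\<^sup>2 + 2 * r * (l \<bullet> m)) / 4)"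
proof -
  interpret prob_space "mehler_joint r :: ((real ^ 'n) \<times> (real ^ 'n)) measure"
    by (rule prob_space_mehler_joint)
  have int: "integrable (mehler_joint r) (\<lambda>w. iexp a * iexp ((l, m) \<bullet> w))"
    by (rule integrable_const_bound[where B=1]) (auto simp: norm_mult)
  have "(\<integral>w. cos ((l, m) \<bullet> w + a) \<partial>mehler_joint r) = (\<integral>w. Re (iexp a * iexp ((l, m) \<bullet> w)) \<partial>mehler_joint r)"
    by (intro Bochner_Integration.integral_cong refl)
      (simp add: cos_add exp_Euler Re_divide cos_of_real sin_of_real)
  also have "\<dots> = Re (\<integral>w. iexp a * iexp ((l, m) \<bullet> w) \<partial>mehler_joint r)"
    by (rule integral_Re[OF int])
  also have "\<dots> = Re (iexp a * complex_of_real (exp (- ((norm l)\<^sup>2 + (norm m)\<^sup>2 + 2 * r * (l \<bullet> m)) / 4)))"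
    by (simp only: integral_mult_right_zero iexp_mehler_joint[OF r])
  finally show ?thesis by (simp add: exp_Euler cos_of_real sin_of_real)
qed

lemma mehler_joint_snd: "distr (mehler_joint r) borel snd = (gauss :: (real ^ 'n) measure)"
proof -
  interpret pair_prob_space "gauss :: (real ^ 'n) measure" "gauss :: (real ^ 'n) measure"
    by (rule pair_prob_space_gauss)
  have "distr (mehler_joint r) borel snd = distr (gauss \<Otimes>\<^sub>M gauss) borel (fst :: (real ^ 'n) \<times> (real ^ 'n) \<Rightarrow> _)"
    unfolding mehler_joint_def by (subst distr_distr) (auto simp: o_def split_def)
  also have "\<dots> = distr (gauss \<Otimes>\<^sub>M (gauss :: (real ^ 'n) measure)) gauss fst"
    by (rule distr_cong) auto
  also have "\<dots> = gauss" by (rule M1.distr_pair_fst)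
  finally show ?thesis .
qed

lemma nn_integral_mehler_joint:
  fixes F :: "(real ^ 'n) \<times> (real ^ 'n) \<Rightarrow> ennreal"
  assumes t: "t > 0" and [measurable]: "F \<in> borel_measurable borel"
  shows "integral\<^sup>N (mehler_joint (exp (- t))) F
    = (\<integral>\<^sup>+ x. (\<integral>\<^sup>+ y. ennreal (mehler_kernel t x y) * F (y, x) \<partial>gauss) \<partial>gauss)"
proof -
  interpret pair_prob_space "gauss :: (real ^ 'n) measure" "gauss :: (real ^ 'n) measure"
    by (rule pair_prob_space_gauss)
  let ?r = "exp (- t)"
  have "integral\<^sup>N (mehler_joint ?r) F
    = (\<integral>\<^sup>+ x. (\<integral>\<^sup>+ z. F (?r *\<^sub>R x + sqrt (1 - ?r\<^sup>2) *\<^sub>R z, x) \<partial>gauss) \<partial>gauss)"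
    unfolding mehler_joint_def
    by (subst nn_integral_distr) (auto simp: M1.nn_integral_fst[symmetric] split_def)
  also have "\<dots> = (\<integral>\<^sup>+ x. (\<integral>\<^sup>+ y. ennreal (mehler_kernel t x y) * F (y, x) \<partial>gauss) \<partial>gauss)"
  proof (rule nn_integral_cong)
    fix x :: "real ^ 'n"
    have "(\<integral>\<^sup>+ z. F (?r *\<^sub>R x + sqrt (1 - ?r\<^sup>2) *\<^sub>R z, x) \<partial>gauss)
      = (\<integral>\<^sup>+ y. F (y, x) \<partial>distr gauss borel (\<lambda>z. ?r *\<^sub>R x + sqrt (1 - ?r\<^sup>2) *\<^sub>R z))"
      by (subst nn_integral_distr) auto
    also have "\<dots> = (\<integral>\<^sup>+ y. ennreal (mehler_kernel t x y) * F (y, x) \<partial>gauss)"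
      unfolding density_mehler_kernel[OF t, symmetric] by (subst nn_integral_density) auto
    finally show "(\<integral>\<^sup>+ z. F (?r *\<^sub>R x + sqrt (1 - ?r\<^sup>2) *\<^sub>R z, x) \<partial>gauss)
      = (\<integral>\<^sup>+ y. ennreal (mehler_kernel t x y) * F (y, x) \<partial>gauss)" .
  qed
  finally show ?thesis .
qed

lemma nn_integral_mehler_kernel:
  fixes x :: "real ^ 'n"
  assumes t: "t > 0"
  shows "(\<integral>\<^sup>+ y. ennreal (mehler_kernel t x y) \<partial>gauss) = 1"
proof -
  interpret prob_space "gauss :: (real ^ 'n) measure" by (rule prob_space_gauss)
  interpret D: prob_space "density gauss (\<lambda>y. ennreal (mehler_kernel t x y))"
    unfolding density_mehler_kernel[OF t] by (rule prob_space_distr) auto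
  have "emeasure (density gauss (\<lambda>y. ennreal (mehler_kernel t x y))) UNIV
      = (\<integral>\<^sup>+ y. ennreal (mehler_kernel t x y) \<partial>gauss)"
    by (subst emeasure_density) auto
  then show ?thesis using D.emeasure_space_1 by simp
qed

text \<open>Reversibility: after exchanging the integrals, the symmetry of the kernel allows its
  mass 1 to be integrated out in the other variable.\<close>

lemma mehler_joint_fst:
  assumes t: "t > 0"
  shows "distr (mehler_joint (exp (- t))) borel fst = (gauss :: (real ^ 'n) measure)"
proof (rule measure_eqI)
  interpret pair_prob_space "gauss :: (real ^ 'n) measure" "gauss :: (real ^ 'n) measure"
    by (rule pair_prob_space_gauss)
  fix A :: "(real ^ 'n) set"
  assume "A \<in> sets (distr (mehler_joint (exp (- t))) borel fst)"
  then have [measurable]: "A \<in> sets borel" by simp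
  have "emeasure (distr (mehler_joint (exp (- t))) borel fst) A
      = (\<integral>\<^sup>+ y. indicator A y \<partial>distr (mehler_joint (exp (- t))) borel fst)" by simp
  also have "\<dots> = (\<integral>\<^sup>+ w. indicator A (fst w) \<partial>mehler_joint (exp (- t)))"
    by (subst nn_integral_distr) auto
  also have "\<dots> = (\<integral>\<^sup>+ x. (\<integral>\<^sup>+ y. ennreal (mehler_kernel t x y) * indicator A y \<partial>gauss) \<partial>gauss)"
    by (subst nn_integral_mehler_joint[OF t]) auto
  also have "\<dots> = (\<integral>\<^sup>+ y. (\<integral>\<^sup>+ x. ennreal (mehler_kernel t x y) * indicator A y \<partial>gauss) \<partial>gauss)"
    by (rule Fubini') (simp add: split_def)
  also have "\<dots> = (\<integral>\<^sup>+ y. (\<integral>\<^sup>+ x. ennreal (mehler_kernel t y x) \<partial>gauss) * indicator A y \<partial>gauss)"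
    by (subst mehler_kernel_commute, subst nn_integral_multc) auto
  also have "\<dots> = emeasure gauss A"
    by (simp add: nn_integral_mehler_kernel[OF t])
  finally show "emeasure (distr (mehler_joint (exp (- t))) borel fst) A = emeasure gauss A" .
qed simp

section \<open>Almost periodic functions and the central limit\<close>

lemma cos_scaling_limit:
  "(\<lambda>N. real N * (cos (a * (1 / sqrt (2 * real N))) - 1)) \<longlonglongrightarrow> - (a\<^sup>2) / 4"
proof -
  \<comment> \<open>The expansion is carried out for a positive frequency; evenness of the cosine
    covers negative \<open>a\<close>, and \<open>a = 0\<close> is immediate.\<close>
  have pos: "(\<lambda>N. real N * (cos (c / sqrt (real N)) - 1)) \<longlonglongrightarrow> - (c\<^sup>2) / 2" if "c > 0" for c :: real
    using that by real_asymp (simp add: power2_eq_square)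
  have "(\<lambda>N. real N * (cos (\<bar>a\<bar> / sqrt 2 / sqrt (real N)) - 1)) \<longlonglongrightarrow> - ((\<bar>a\<bar> / sqrt 2)\<^sup>2) / 2" if "a \<noteq> 0"
    using that by (intro pos) simp
  moreover have "cos (\<bar>a\<bar> / sqrt 2 / sqrt (real N)) = cos (a * (1 / sqrt (2 * real N)))" for N
    by (cases "a \<ge> 0") (auto simp: real_sqrt_mult)
  ultimately show ?thesis by (cases "a = 0") (auto simp: power_divide)
qed

text \<open>The base and \<open>exp (- q / N)\<close> differ by \<open>o(1 / N)\<close>, and both
  have modulus at most 1, so their \<open>N\<close>-th powers differ by at most \<open>N\<close>
  times that difference. The comparison avoids the logarithm of the base, which can be negative for
  small \<open>N\<close>.\<close>

lemma cos_mixture_power_limit: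
  assumes r: "0 \<le> r" "r \<le> 1"
  shows "(\<lambda>N. ((1 + r) / 2 * cos (a * (1 / sqrt (2 * real N))) + (1 - r) / 2 * cos (b * (1 / sqrt (2 * real N)))) ^ N)
    \<longlonglongrightarrow> exp (- ((1 + r) / 2 * a\<^sup>2 + (1 - r) / 2 * b\<^sup>2) / 4)"
proof -
  define q where "q = ((1 + r) / 2 * a\<^sup>2 + (1 - r) / 2 * b\<^sup>2) / 4"
  define c where "c N = (1 + r) / 2 * cos (a * (1 / sqrt (2 * real N))) + (1 - r) / 2 * cos (b * (1 / sqrt (2 * real N)))" for N
  have q: "0 \<le> q" using r by (simp add: q_def)
  have cle: "\<bar>c N\<bar> \<le> 1" for N
  proof -
    have "\<bar>c N\<bar> \<le> (1 + r) / 2 * \<bar>cos (a * (1 / sqrt (2 * real N)))\<bar> + (1 - r) / 2 * \<bar>cos (b * (1 / sqrt (2 * real N)))\<bar>"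
      unfolding c_def using r by (intro order_trans[OF abs_triangle_ineq]) (simp add: abs_mult)
    also have "\<dots> \<le> (1 + r) / 2 * 1 + (1 - r) / 2 * 1"
      using r by (intro add_mono mult_left_mono) auto
    finally show ?thesis by (simp add: field_simps)
  qed
  have "(\<lambda>N. (1 + r) / 2 * (real N * (cos (a * (1 / sqrt (2 * real N))) - 1))
      + (1 - r) / 2 * (real N * (cos (b * (1 / sqrt (2 * real N))) - 1)))
    \<longlonglongrightarrow> (1 + r) / 2 * (- (a\<^sup>2) / 4) + (1 - r) / 2 * (- (b\<^sup>2) / 4)"
    by (intro tendsto_intros cos_scaling_limit)
  also have "(\<lambda>N. (1 + r) / 2 * (real N * (cos (a * (1 / sqrt (2 * real N))) - 1))
      + (1 - r) / 2 * (real N * (cos (b * (1 / sqrt (2 * real N))) - 1))) = (\<lambda>N. real N * (c N - 1))"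
    by (simp add: fun_eq_iff c_def field_simps)
  also have "(1 + r) / 2 * (- (a\<^sup>2) / 4) + (1 - r) / 2 * (- (b\<^sup>2) / 4) = - q"
    by (simp add: q_def field_simps)
  finally have 1: "(\<lambda>N. real N * (c N - 1)) \<longlonglongrightarrow> - q" .
  have 2: "(\<lambda>N. real N * (exp (- q / real N) - 1)) \<longlonglongrightarrow> - q"
    by real_asymp
  have 3: "(\<lambda>N. real N * \<bar>c N - exp (- q / real N)\<bar>) \<longlonglongrightarrow> 0"
  proof -
    have "\<bar>real N * (c N - 1) - real N * (exp (- q / real N) - 1)\<bar> = real N * \<bar>c N - exp (- q / real N)\<bar>" for N
    proof -
      have "real N * (c N - 1) - real N * (exp (- q / real N) - 1) = real N * (c N - exp (- q / real N))"
        by (simp only: right_diff_distrib)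
      then show ?thesis by (simp add: abs_mult)
    qed
    then show ?thesis using tendsto_rabs[OF tendsto_diff[OF 1 2]] by simp
  qed
  have "(\<lambda>N. c N ^ N - exp (- q)) \<longlonglongrightarrow> 0"
  proof (rule Lim_null_comparison[OF _ 3])
    show "\<forall>\<^sub>F N in sequentially. norm (c N ^ N - exp (- q)) \<le> real N * \<bar>c N - exp (- q / real N)\<bar>"
      using eventually_gt_at_top[of 0]
    proof eventually_elim
      case (elim N)
      have "exp (- q) = exp (- q / real N) ^ N" using elim by (simp add: exp_of_nat_mult[symmetric])
      moreover have "norm (c N ^ N - exp (- q / real N) ^ N) \<le> real N * norm (c N - exp (- q / real N))"
        using cle q by (intro norm_power_diff) auto
      ultimately show ?case by simp
    qed
  qed
  then have "(\<lambda>N. c N ^ N) \<longlonglongrightarrow> exp (- q)" by (rule LIM_zero_cancel)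
  then show ?thesis unfolding c_def q_def by (simp only: minus_divide_left)
qed

section \<open>Trigonometric polynomials and their uniform closure\<close>

inductive trig_poly :: "('a::euclidean_space \<Rightarrow> real) \<Rightarrow> bool" where
  cos: "trig_poly (\<lambda>x. cos (l \<bullet> x + a))"
| add: "trig_poly f \<Longrightarrow> trig_poly g \<Longrightarrow> trig_poly (\<lambda>x. f x + g x)"
| cmult: "trig_poly f \<Longrightarrow> trig_poly (\<lambda>x. c * f x)"

lemma trig_poly_const: "trig_poly (\<lambda>x. c)"
  using trig_poly.cmult[OF trig_poly.cos[of 0 0], of c] by simp

text \<open>The product-to-sum formula, with the free phase \<open>a\<close> accounting for sines,
  makes the class an algebra, as Stone--Weierstrass demands.\<close>

lemma trig_poly_mult:
  assumes "trig_poly f" "trig_poly g"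
  shows "trig_poly (\<lambda>x. f x * g x)"
  using assms(1)
proof induction
  case (cos l a)
  show ?case using assms(2)
  proof induction
    case (cos m b)
    have "trig_poly (\<lambda>x. 1 / 2 * (cos ((l - m) \<bullet> x + (a - b)) + cos ((l + m) \<bullet> x + (a + b))))"
      by (intro trig_poly.intros)
    also have "(\<lambda>x. 1 / 2 * (cos ((l - m) \<bullet> x + (a - b)) + cos ((l + m) \<bullet> x + (a + b)))) = (\<lambda>x. cos (l \<bullet> x + a) * cos (m \<bullet> x + b))"
      by (simp add: fun_eq_iff cos_times_cos inner_diff_left inner_add_left algebra_simps)
    finally show ?case .
  next
    case (add f g)
    then show ?case by (simp add: distrib_left trig_poly.add)
  next
    case (cmult f c)
    then show ?case using trig_poly.cmult by (simp add: mult.left_commute)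
  qed
next
  case (add f g)
  then show ?case by (simp add: distrib_right trig_poly.add)
next
  case (cmult f c)
  then show ?case using trig_poly.cmult by (simp add: mult.assoc)
qed

lemma trig_poly_continuous: "trig_poly f \<Longrightarrow> continuous_on S f"
  by (induction rule: trig_poly.induct) (auto intro!: continuous_intros)

lemma trig_poly_bounded: "trig_poly f \<Longrightarrow> \<exists>B. \<forall>x. \<bar>f x\<bar> \<le> B"
proof (induction rule: trig_poly.induct)
  case (add f g)
  then show ?case by (meson abs_triangle_ineq add_mono order_trans)
next
  case (cmult f c)
  then show ?case by (metis abs_ge_zero abs_mult mult_left_mono)
qed (auto intro: exI[of _ 1])

text \<open>\<open>T'\<close> acts as the adjoint of \<open>T\<close> and moves the change of
  variables to the frequency. The projections \<open>fst\<close> and \<open>snd\<close> are the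
  cases of interest.\<close>

lemma trig_poly_linear:
  assumes "trig_poly f" and T: "\<And>l x. l \<bullet> T x = T' l \<bullet> x"
  shows "trig_poly (\<lambda>x. f (T x))"
  using assms(1) by induction (auto simp: T intro: trig_poly.intros)

lemma trig_poly_polynomial:
  assumes "real_polynomial_function q" "trig_poly f"
  shows "trig_poly (\<lambda>x. q (f x))"
  using assms(1)
proof induction
  case (linear h)
  then have "h = (\<lambda>x. h 1 * x)"
    using real_bounded_linear by (metis bounded_linear_def linear_cmul mult.commute mult.right_neutral real_scaleR_def)
  then show ?case using trig_poly.cmult[OF assms(2), of "h 1"] by metis
qed (auto intro: trig_poly_const trig_poly.add trig_poly_mult)

text \<open>By Bohr's theorem these are the uniformly almost periodic functions.\<close>

definition almost_periodic :: "('a::euclidean_space \<Rightarrow> real) \<Rightarrow> bool" where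
  "almost_periodic f \<longleftrightarrow> (\<forall>e>0. \<exists>g. trig_poly g \<and> (\<forall>x. \<bar>f x - g x\<bar> \<le> e))"

lemma almost_periodicD:
  assumes "almost_periodic f" "e > 0"
  obtains g where "trig_poly g" "\<And>x. \<bar>f x - g x\<bar> \<le> e"
  using assms unfolding almost_periodic_def by blast

lemma trig_poly_imp_almost_periodic: "trig_poly f \<Longrightarrow> almost_periodic f"
  unfolding almost_periodic_def by (auto intro!: exI[of _ f])

lemma almost_periodic_bounded:
  assumes "almost_periodic f"
  obtains B where "\<And>x. \<bar>f x\<bar> \<le> B"
proof -
  obtain g where g: "trig_poly g" "\<And>x. \<bar>f x - g x\<bar> \<le> 1"
    using almost_periodicD[OF assms zero_less_one] by blast
  obtain B where B: "\<And>x. \<bar>g x\<bar> \<le> B" using trig_poly_bounded[OF g(1)] by blast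
  have "\<bar>f x\<bar> \<le> B + 1" for x
    using g(2)[of x] B[of x] by linarith
  then show ?thesis by (rule that)
qed

text \<open>Weierstrass approximation of \<open>\<phi>\<close> by a polynomial on an interval
  containing the range; a polynomial of a trigonometric polynomial is again one. Powers
  \<open>|f|^q\<close> and clamped functions enter the closure this way.\<close>

lemma almost_periodic_compose:
  fixes \<phi> :: "real \<Rightarrow> real"
  assumes f: "almost_periodic f" and \<phi>: "continuous_on UNIV \<phi>"
  shows "almost_periodic (\<lambda>x. \<phi> (f x))"
  unfolding almost_periodic_def
proof (intro allI impI)
  fix e :: real assume e: "e > 0"
  obtain B where B: "\<And>x. \<bar>f x\<bar> \<le> B" using almost_periodic_bounded[OF f] by blast
  \<comment> \<open>The margin 1 makes room for the approximant \<open>g\<close>, which is kept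
    within distance 1 of \<open>f\<close> and so also takes its values in \<open>?K\<close>.\<close>
  let ?K = "{- B - 1..B + 1}"
  obtain q where q: "real_polynomial_function q" "\<And>x. x \<in> ?K \<Longrightarrow> \<bar>\<phi> x - q x\<bar> < e / 2"
    using Stone_Weierstrass_real_polynomial_function[of ?K \<phi> "e/2"] \<phi> e
    by (metis compact_Icc continuous_on_subset half_gt_zero subset_UNIV)
  have "uniformly_continuous_on ?K \<phi>"
    using \<phi> by (intro compact_uniformly_continuous) (auto intro: continuous_on_subset)
  then obtain d where d: "d > 0" "\<And>x y. x \<in> ?K \<Longrightarrow> y \<in> ?K \<Longrightarrow> dist x y < d \<Longrightarrow> dist (\<phi> x) (\<phi> y) < e / 2"
    unfolding uniformly_continuous_on_def using e by (metis dist_commute half_gt_zero)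
  obtain g where g: "trig_poly g" "\<And>x. \<bar>f x - g x\<bar> \<le> min 1 (d / 2)"
    using almost_periodicD[OF f, of "min 1 (d/2)"] d by (metis half_gt_zero min_less_iff_conj zero_less_one)
  have "\<bar>\<phi> (f x) - q (g x)\<bar> \<le> e" for x
  proof -
    have k: "f x \<in> ?K" "g x \<in> ?K" using B[of x] g(2)[of x] by auto
    have "dist (f x) (g x) < d" using g(2)[of x] d(1) by (auto simp: dist_real_def)
    then have "\<bar>\<phi> (f x) - \<phi> (g x)\<bar> < e / 2" using d(2)[OF k] by (simp add: dist_real_def)
    then show ?thesis using q(2)[OF k(2)] by linarith
  qed
  then show "\<exists>g. trig_poly g \<and> (\<forall>x. \<bar>\<phi> (f x) - g x\<bar> \<le> e)"
    using trig_poly_polynomial[OF q(1) g(1)] by blast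
qed

lemma almost_periodic_add:
  assumes "almost_periodic f" "almost_periodic g"
  shows "almost_periodic (\<lambda>x. f x + g x)"
  unfolding almost_periodic_def
proof (intro allI impI)
  fix e :: real assume "e > 0"
  then have e2: "e / 2 > 0" by simp
  obtain f' where f': "trig_poly f'" "\<And>x. \<bar>f x - f' x\<bar> \<le> e / 2"
    using almost_periodicD[OF assms(1) e2] by blast
  obtain g' where g': "trig_poly g'" "\<And>x. \<bar>g x - g' x\<bar> \<le> e / 2"
    using almost_periodicD[OF assms(2) e2] by blast
  have "\<bar>f x + g x - (f' x + g' x)\<bar> \<le> e" for x
    using f'(2)[of x] g'(2)[of x] by linarith
  then show "\<exists>h. trig_poly h \<and> (\<forall>x. \<bar>f x + g x - h x\<bar> \<le> e)"
    using trig_poly.add[OF f'(1) g'(1)] by blast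
qed

text \<open>Polarization expresses the product through squares, which are continuous functions of
  sums.\<close>

lemma almost_periodic_mult:
  assumes "almost_periodic f" "almost_periodic g"
  shows "almost_periodic (\<lambda>x. f x * g x)"
proof -
  have "almost_periodic (\<lambda>x. (1 / 4) * (f x + g x)\<^sup>2 + (- 1 / 4) * (f x + - 1 * g x)\<^sup>2)"
    by (intro almost_periodic_add assms almost_periodic_compose[where \<phi> = "\<lambda>u. (1 / 4) * u\<^sup>2"]
      almost_periodic_compose[where \<phi> = "\<lambda>u. (- 1 / 4) * u\<^sup>2"] almost_periodic_compose[where \<phi> = "\<lambda>u. - 1 * u"])
      (auto intro!: continuous_intros)
  also have "(\<lambda>x. (1 / 4) * (f x + g x)\<^sup>2 + (- 1 / 4) * (f x + - 1 * g x)\<^sup>2) = (\<lambda>x. f x * g x)"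
    by (simp add: fun_eq_iff power2_eq_square field_simps)
  finally show ?thesis .
qed

lemma almost_periodic_linear:
  assumes "almost_periodic f" and "\<And>l x. l \<bullet> T x = T' l \<bullet> x"
  shows "almost_periodic (\<lambda>x. f (T x))"
  using assms unfolding almost_periodic_def by (metis trig_poly_linear)

lemma almost_periodic_fst: "almost_periodic f \<Longrightarrow> almost_periodic (\<lambda>w. f (fst w))"
  by (rule almost_periodic_linear[where T' = "\<lambda>l. (l, 0)"]) auto

lemma almost_periodic_snd: "almost_periodic f \<Longrightarrow> almost_periodic (\<lambda>w. f (snd w))"
  by (rule almost_periodic_linear[where T' = "\<lambda>l. (0, l)"]) auto

lemma almost_periodic_continuous:
  assumes "almost_periodic f"
  shows "continuous_on UNIV f"
proof -
  have "\<forall>n. \<exists>g. trig_poly g \<and> (\<forall>x. \<bar>f x - g x\<bar> \<le> 1 / real (Suc n))"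
    using assms unfolding almost_periodic_def by simp
  then obtain g where g: "\<And>n. trig_poly (g n)" "\<And>n x. \<bar>f x - g n x\<bar> \<le> 1 / real (Suc n)"
    by metis
  have "uniform_limit UNIV g f sequentially"
  proof (rule uniform_limitI)
    fix e :: real assume "e > 0"
    then have "\<forall>\<^sub>F n in sequentially. 1 / real (Suc n) < e" by real_asymp
    then show "\<forall>\<^sub>F n in sequentially. \<forall>x\<in>UNIV. dist (g n x) (f x) < e"
    proof eventually_elim
      case (elim n)
      then show ?case using g(2)[of _ n] by (auto simp: dist_real_def abs_minus_commute intro: le_less_trans)
    qed
  qed
  then show ?thesis
    by (rule uniform_limit_theorem[rotated]) (auto simp: g trig_poly_continuous)
qed

text \<open>Steps of a random walk whose endpoint converges in law to \<open>gauss\<close>: \<open>N\<close> steps of length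
  \<open>1 / sqrt (2 N)\<close> along each coordinate axis.\<close>

definition walk_steps :: "nat \<Rightarrow> 'a::euclidean_space list" where
  "walk_steps N = concat (replicate N
     (map (\<lambda>b. (1 / sqrt (2 * real N)) *\<^sub>R b) (SOME bs. set bs = Basis \<and> distinct bs)))"

text \<open>A commutative product forgets both the order of the steps and the chosen enumeration of
  \<open>Basis\<close>; the \<open>N\<close> repetitions become \<open>N\<close>-th powers.\<close>

lemma prod_list_walk_steps:
  fixes h :: "'a::euclidean_space \<Rightarrow> real"
  shows "(\<Prod>v\<leftarrow>walk_steps N. h v) = (\<Prod>b\<in>Basis. h ((1 / sqrt (2 * real N)) *\<^sub>R b) ^ N)"
proof -
  have "\<exists>bs. set bs = (Basis :: 'a set) \<and> distinct bs"
    using finite_distinct_list[OF finite_Basis] by blast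
  then obtain bs where bs: "bs = (SOME bs. set bs = (Basis :: 'a set) \<and> distinct bs)"
    "set bs = (Basis :: 'a set)" "distinct bs"
    by (metis (mono_tags, lifting) someI_ex)
  have rep: "(\<Prod>v\<leftarrow>concat (replicate M xs). h v) = (\<Prod>v\<leftarrow>xs. h v) ^ M" for M xs
    by (induction M) auto
  have "(\<Prod>v\<leftarrow>walk_steps N. h v) = (\<Prod>b\<leftarrow>bs. h ((1 / sqrt (2 * real N)) *\<^sub>R b)) ^ N"
    unfolding walk_steps_def bs(1)[symmetric] rep by (simp add: o_def)
  also have "\<dots> = (\<Prod>b\<in>Basis. h ((1 / sqrt (2 * real N)) *\<^sub>R b)) ^ N"
    unfolding prod.distinct_set_conv_list[OF bs(3), symmetric] bs(2) ..
  finally show ?thesis by (simp add: prod_power_distrib)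
qed

text \<open>The central limit theorem tested on characters. The average of a cosine is an explicit
  product of \<open>N\<close>-th powers, one for each axis, and converges factor by factor; sums and
  multiples follow by linearity.\<close>

lemma cube_avg_tendsto_trig_poly:
  fixes F :: "(real ^ 'n) \<times> (real ^ 'n) \<Rightarrow> real"
  assumes r: "0 \<le> r" "r \<le> 1" and F: "trig_poly F"
  shows "(\<lambda>N. cube_avg r (walk_steps N) F 0) \<longlonglongrightarrow> integral\<^sup>L (mehler_joint r) F"
  using F
proof induction
  interpret prob_space "mehler_joint r :: ((real ^ 'n) \<times> (real ^ 'n)) measure"
    by (rule prob_space_mehler_joint)
  have int: "integrable (mehler_joint r) f" if f: "trig_poly f" for f :: "(real ^ 'n) \<times> (real ^ 'n) \<Rightarrow> real"
  proof -
    obtain B where "\<And>x. \<bar>f x\<bar> \<le> B" using trig_poly_bounded[OF f] by blast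
    then show ?thesis
      using borel_measurable_continuous_onI[OF trig_poly_continuous[OF f]]
      by (intro integrable_const_bound[where B=B]) auto
  qed
  {
    case (cos lm a)
    obtain l m where lm: "lm = (l, m)" by (cases lm)
    have "(\<lambda>N. cos a * (\<Prod>b\<in>(Basis :: (real ^ 'n) set). ((1 + r) / 2 * cos (((l + m) \<bullet> b) * (1 / sqrt (2 * real N)))
            + (1 - r) / 2 * cos (((l - m) \<bullet> b) * (1 / sqrt (2 * real N)))) ^ N))
        \<longlonglongrightarrow> cos a * (\<Prod>b\<in>(Basis :: (real ^ 'n) set). exp (- ((1 + r) / 2 * ((l + m) \<bullet> b)\<^sup>2 + (1 - r) / 2 * ((l - m) \<bullet> b)\<^sup>2) / 4))"
      by (intro tendsto_intros cos_mixture_power_limit r)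
    also have "(\<lambda>N. cos a * (\<Prod>b\<in>(Basis :: (real ^ 'n) set). ((1 + r) / 2 * cos (((l + m) \<bullet> b) * (1 / sqrt (2 * real N)))
            + (1 - r) / 2 * cos (((l - m) \<bullet> b) * (1 / sqrt (2 * real N)))) ^ N))
        = (\<lambda>N. cube_avg r (walk_steps N) (\<lambda>z. cos (lm \<bullet> z + a)) 0)"
      unfolding lm cube_avg_cos prod_list_walk_steps by (simp add: mult.commute)
    also have "cos a * (\<Prod>b\<in>(Basis :: (real ^ 'n) set). exp (- ((1 + r) / 2 * ((l + m) \<bullet> b)\<^sup>2 + (1 - r) / 2 * ((l - m) \<bullet> b)\<^sup>2) / 4))
        = (\<integral>w. cos (lm \<bullet> w + a) \<partial>mehler_joint r)"
    proof -
      have nrm: "(norm v)\<^sup>2 = (\<Sum>b\<in>Basis. (v \<bullet> b)\<^sup>2)" for v :: "real ^ 'n"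
        unfolding power2_norm_eq_inner by (subst euclidean_inner) (simp add: power2_eq_square)
      have "(\<Sum>b\<in>Basis. - ((1 + r) / 2 * ((l + m) \<bullet> b)\<^sup>2 + (1 - r) / 2 * ((l - m) \<bullet> b)\<^sup>2) / 4)
          = - ((1 + r) / 2 * (norm (l + m))\<^sup>2 + (1 - r) / 2 * (norm (l - m))\<^sup>2) / 4"
        unfolding nrm by (simp only: sum_negf sum.distrib sum_distrib_left[symmetric] sum_divide_distrib[symmetric])
      \<comment> \<open>The weighted parallelogram identity matches the covariance of the limiting
        walk with that of \<open>mehler_joint\<close>: the squared norms receive total weight 1, the
        mixed terms \<open>2 r\<close>.\<close>
      also have "(1 + r) / 2 * (norm (l + m))\<^sup>2 + (1 - r) / 2 * (norm (l - m))\<^sup>2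
          = (norm l)\<^sup>2 + (norm m)\<^sup>2 + 2 * r * (l \<bullet> m)"
        unfolding power2_norm_eq_inner
        by (simp add: inner_diff_left inner_diff_right inner_add_left inner_add_right inner_commute[of m l] field_simps)
      finally show ?thesis unfolding lm cos_mehler_joint[OF r] by (simp add: exp_sum[symmetric])
    qed
    finally show ?case .
  next
    case (add f g)
    then show ?case unfolding cube_avg_add by (simp add: int tendsto_add)
  next
    case (cmult f c)
    then show ?case unfolding cube_avg_cmult by (simp add: tendsto_mult_left)
  }
qed

text \<open>Both sides are averages, so a uniform error of \<open>e / 3\<close> in the integrand
  costs at most \<open>e / 3\<close> on each, whatever the number of steps.\<close>

lemma cube_avg_tendsto_almost_periodic:
  fixes F :: "(real ^ 'n) \<times> (real ^ 'n) \<Rightarrow> real"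
  assumes r: "0 \<le> r" "r \<le> 1" and F: "almost_periodic F"
  shows "(\<lambda>N. cube_avg r (walk_steps N) F 0) \<longlonglongrightarrow> integral\<^sup>L (mehler_joint r) F"
proof (rule LIMSEQ_I)
  interpret prob_space "mehler_joint r :: ((real ^ 'n) \<times> (real ^ 'n)) measure"
    by (rule prob_space_mehler_joint)
  have int: "integrable (mehler_joint r) f" if f: "almost_periodic f" for f :: "(real ^ 'n) \<times> (real ^ 'n) \<Rightarrow> real"
  proof -
    obtain B where "\<And>x. \<bar>f x\<bar> \<le> B" using almost_periodic_bounded[OF f] by blast
    then show ?thesis
      using borel_measurable_continuous_onI[OF almost_periodic_continuous[OF f]]
      by (intro integrable_const_bound[where B=B]) auto
  qed
  fix e :: real assume e: "e > 0"
  obtain G where G: "trig_poly G" "\<And>x. \<bar>F x - G x\<bar> \<le> e / 3"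
    using almost_periodicD[OF F, of "e / 3"] e by auto
  have iF: "integrable (mehler_joint r) F" by (intro int F)
  have iG: "integrable (mehler_joint r) G" by (intro int trig_poly_imp_almost_periodic G)
  have "\<bar>integral\<^sup>L (mehler_joint r) F - integral\<^sup>L (mehler_joint r) G\<bar> = \<bar>\<integral>w. F w - G w \<partial>mehler_joint r\<bar>"
    by (simp add: iF iG)
  also have "\<dots> \<le> (\<integral>w. \<bar>F w - G w\<bar> \<partial>mehler_joint r)" by (rule integral_abs_bound)
  also have "\<dots> \<le> e / 3" using G(2) iG iF by (intro integral_le_const AE_I2) auto
  finally have 1: "\<bar>integral\<^sup>L (mehler_joint r) F - integral\<^sup>L (mehler_joint r) G\<bar> \<le> e / 3" .
  have 2: "\<bar>cube_avg r vs F z - cube_avg r vs G z\<bar> \<le> e / 3" for vs z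
    unfolding cube_avg_diff[symmetric] by (rule cube_avg_abs_le[OF r G(2)])
  obtain N0 where N0: "\<And>N. N \<ge> N0 \<Longrightarrow> \<bar>cube_avg r (walk_steps N) G 0 - integral\<^sup>L (mehler_joint r) G\<bar> < e / 3"
    using LIMSEQ_D[OF cube_avg_tendsto_trig_poly[OF r G(1)], of "e / 3"] e by auto
  have "norm (cube_avg r (walk_steps N) F 0 - integral\<^sup>L (mehler_joint r) F) < e" if "N \<ge> N0" for N
    using 1 2[of "walk_steps N" 0] N0[OF that] unfolding real_norm_def by linarith
  then show "\<exists>N0. \<forall>N\<ge>N0. norm (cube_avg r (walk_steps N) F 0 - integral\<^sup>L (mehler_joint r) F) < e"
    by blast
qed

text \<open>The product of \<open>f\<close> and \<open>g\<close>, the power of \<open>|f|\<close>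
  and the square of \<open>g\<close> are all almost periodic, so every average in the cube
  inequality converges to the corresponding integral.\<close>

lemma hypercontractive_almost_periodic:
  fixes f g :: "real ^ 'n \<Rightarrow> real"
  assumes r: "0 < r" "r \<le> 1" and f: "almost_periodic f" and g: "almost_periodic g"
  shows "\<bar>\<integral>w. f (fst w) * g (snd w) \<partial>mehler_joint r\<bar>
    \<le> (\<integral>w. \<bar>f (fst w)\<bar> powr (1 + r\<^sup>2) \<partial>mehler_joint r) powr (1 / (1 + r\<^sup>2))
      * sqrt (\<integral>w. (g (snd w))\<^sup>2 \<partial>mehler_joint r)"
proof (rule LIMSEQ_le)
  have r': "0 \<le> r" using r by simp
  have p: "1 + r\<^sup>2 > 0" by (simp add: add_pos_nonneg)
  note lim = cube_avg_tendsto_almost_periodic[OF r' r(2)]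
  show "(\<lambda>N. \<bar>cube_avg r (walk_steps N) (\<lambda>w. f (fst w) * g (snd w)) 0\<bar>)
    \<longlonglongrightarrow> \<bar>\<integral>w. f (fst w) * g (snd w) \<partial>mehler_joint r\<bar>"
    by (intro tendsto_rabs lim almost_periodic_mult almost_periodic_fst almost_periodic_snd f g)
  have c: "continuous_on UNIV (\<lambda>u::real. \<bar>u\<bar> powr (1 + r\<^sup>2))"
    using p by (intro continuous_on_powr' continuous_intros) auto
  show "(\<lambda>N. cube_avg r (walk_steps N) (\<lambda>w. \<bar>f (fst w)\<bar> powr (1 + r\<^sup>2)) 0 powr (1 / (1 + r\<^sup>2))
      * sqrt (cube_avg r (walk_steps N) (\<lambda>w. (g (snd w))\<^sup>2) 0))
    \<longlonglongrightarrow> (\<integral>w. \<bar>f (fst w)\<bar> powr (1 + r\<^sup>2) \<partial>mehler_joint r) powr (1 / (1 + r\<^sup>2))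
      * sqrt (\<integral>w. (g (snd w))\<^sup>2 \<partial>mehler_joint r)"
  proof (intro tendsto_mult tendsto_real_sqrt tendsto_powr' tendsto_const)
    show "(\<lambda>N. cube_avg r (walk_steps N) (\<lambda>w. \<bar>f (fst w)\<bar> powr (1 + r\<^sup>2)) 0)
        \<longlonglongrightarrow> (\<integral>w. \<bar>f (fst w)\<bar> powr (1 + r\<^sup>2) \<partial>mehler_joint r)"
      by (intro lim almost_periodic_fst[where f="\<lambda>x. \<bar>f x\<bar> powr (1 + r\<^sup>2)"] almost_periodic_compose[OF f] c)
    show "(\<lambda>N. cube_avg r (walk_steps N) (\<lambda>w. (g (snd w))\<^sup>2) 0) \<longlonglongrightarrow> (\<integral>w. (g (snd w))\<^sup>2 \<partial>mehler_joint r)"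
      by (intro lim almost_periodic_snd[where f="\<lambda>x. (g x)\<^sup>2"] almost_periodic_compose[OF g, where \<phi>="\<lambda>u. u\<^sup>2"] continuous_intros)
  qed (use p r in \<open>auto intro!: always_eventually cube_avg_nonneg\<close>)
  show "\<exists>N0. \<forall>N\<ge>N0. \<bar>cube_avg r (walk_steps N) (\<lambda>w. f (fst w) * g (snd w)) 0\<bar>
      \<le> cube_avg r (walk_steps N) (\<lambda>w. \<bar>f (fst w)\<bar> powr (1 + r\<^sup>2)) 0 powr (1 / (1 + r\<^sup>2))
        * sqrt (cube_avg r (walk_steps N) (\<lambda>w. (g (snd w))\<^sup>2) 0)"
    using hypercube_hypercontractive[OF r, of _ f g 0 0] by (simp add: zero_prod_def)
qed

section \<open>Nelson's hypercontractivity\<close>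

text \<open>Stone--Weierstrass controls the approximant on the ball of radius \<open>n\<close> only.
  Clamping to \<open>[-B, B]\<close> bounds it elsewhere and, being 1-Lipschitz and fixing the
  values of \<open>f\<close>, does not increase the error.\<close>

lemma bounded_continuous_imp_almost_periodic_limit:
  fixes f :: "'a::euclidean_space \<Rightarrow> real"
  assumes f: "continuous_on UNIV f" and B: "\<And>x. \<bar>f x\<bar> \<le> B"
  obtains h where "\<And>n. almost_periodic (h n)" "\<And>n x. \<bar>h n x\<bar> \<le> B" "\<And>x. (\<lambda>n. h n x) \<longlonglongrightarrow> f x"
proof -
  have "\<exists>g. trig_poly g \<and> (\<forall>x\<in>cball 0 (real n). \<bar>f x - g x\<bar> < 1 / real (Suc n))" for n
  proof -
    interpret function_ring_on "Collect trig_poly :: ('a \<Rightarrow> real) set" "cball 0 (real n)"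
    proof
      fix x y :: 'a assume ne: "x \<noteq> y"
      \<comment> \<open>Normalized so that the phases at \<open>x\<close> and \<open>y\<close>
        differ by 1; shifting the phase at \<open>y\<close> to 0 separates the points by
        \<open>cos 1 \<noteq> cos 0\<close>.\<close>
      define l where "l = (1 / (norm (x - y))\<^sup>2) *\<^sub>R (x - y)"
      have "l \<bullet> (x - y) = 1" using ne by (simp add: l_def dot_square_norm)
      then have "l \<bullet> x + - (l \<bullet> y) = 1" by (simp add: inner_diff_right)
      moreover have "cos (1 :: real) \<noteq> 1" using cos_monotone_0_pi[of 0 1] pi_ge_two by simp
      ultimately have "cos (l \<bullet> x + - (l \<bullet> y)) \<noteq> cos (l \<bullet> y + - (l \<bullet> y))" by simp
      then show "\<exists>f\<in>Collect trig_poly. f x \<noteq> f y"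
        using trig_poly.cos[of l "- (l \<bullet> y)"] by (intro bexI[where x = "\<lambda>z. cos (l \<bullet> z + - (l \<bullet> y))"]) auto
    qed (auto intro: trig_poly.intros trig_poly_mult trig_poly_const trig_poly_continuous)
    have "continuous_on (cball 0 (real n)) f" using f by (rule continuous_on_subset) simp
    then show ?thesis using Stone_Weierstrass_basic[of f "1 / real (Suc n)"] by auto
  qed
  then obtain g where g: "\<And>n. trig_poly (g n)"
    "\<And>n x. x \<in> cball 0 (real n) \<Longrightarrow> \<bar>f x - g n x\<bar> < 1 / real (Suc n)" by metis
  define h where "h n x = max (- B) (min B (g n x))" for n x
  have B0: "0 \<le> B" using B[of 0] by linarith
  show ?thesis
  proof
    show "almost_periodic (h n)" for n
      unfolding h_def
      by (intro almost_periodic_compose[where \<phi> = "\<lambda>u. max (- B) (min B u)"] trig_poly_imp_almost_periodic g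
          continuous_intros)
    show "\<bar>h n x\<bar> \<le> B" for n x using B0 by (auto simp: h_def)
    show "(\<lambda>n. h n x) \<longlonglongrightarrow> f x" for x
    proof (rule LIM_zero_cancel, rule Lim_null_comparison)
      obtain n0 where "norm x \<le> real n0" using real_arch_simple by blast
      show "\<forall>\<^sub>F n in sequentially. norm (h n x - f x) \<le> 1 / real (Suc n)"
        using eventually_ge_at_top[of n0]
      proof eventually_elim
        case (elim n)
        then have "\<bar>f x - g n x\<bar> < 1 / real (Suc n)" using \<open>norm x \<le> real n0\<close> by (intro g) simp
        moreover have "\<bar>h n x - f x\<bar> \<le> \<bar>g n x - f x\<bar>" using B[of x] by (auto simp: h_def)
        ultimately show ?case by simp
      qed
      show "(\<lambda>n. 1 / real (Suc n)) \<longlonglongrightarrow> 0" by real_asymp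
    qed
  qed
qed

text \<open>A measurable function is a limit of continuous ones off a Lebesgue negligible set, which
  is null for \<open>gauss\<close> because \<open>gauss\<close> has a density. Clamping restores the
  bound.\<close>

lemma bounded_borel_imp_continuous_limit:
  fixes f :: "real ^ 'n \<Rightarrow> real"
  assumes f: "f \<in> borel_measurable borel" and B: "\<And>x. \<bar>f x\<bar> \<le> B"
  obtains h where "\<And>n. continuous_on UNIV (h n)" "\<And>n x. \<bar>h n x\<bar> \<le> B"
    "AE x in gauss. (\<lambda>n. h n x) \<longlonglongrightarrow> f x"
proof -
  have "f measurable_on UNIV"
    using f by (intro lebesgue_measurable_imp_measurable_on) (auto intro!: measurable_completion)
  then obtain N g where N: "negligible N" and g: "\<And>n. continuous_on UNIV (g n)"
    and lim: "\<And>x. x \<notin> N \<Longrightarrow> (\<lambda>n. g n x) \<longlonglongrightarrow> f x"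
    unfolding measurable_on_def by auto
  have B0: "0 \<le> B" using B[of 0] by linarith
  define h where "h n x = max (- B) (min B (g n x))" for n x
  show ?thesis
  proof
    show "continuous_on UNIV (h n)" for n unfolding h_def by (intro continuous_intros g)
    show "\<bar>h n x\<bar> \<le> B" for n x using B0 by (auto simp: h_def)
    have "(\<lambda>n. h n x) \<longlonglongrightarrow> f x" if "x \<notin> N" for x
    proof -
      have "(\<lambda>n. h n x) \<longlonglongrightarrow> max (- B) (min B (f x))"
        unfolding h_def by (intro tendsto_intros lim that)
      moreover have "max (- B) (min B (f x)) = f x" using B[of x] by auto
      ultimately show ?thesis by simp
    qed
    moreover have "AE x in lborel. x \<notin> N"
      using AE_not_in[of N lebesgue] N by (simp add: negligible_iff_null_sets AE_completion_iff)
    ultimately have "AE x in lborel. (\<lambda>n. h n x) \<longlonglongrightarrow> f x" by (auto elim: eventually_mono)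
    then show "AE x in gauss. (\<lambda>n. h n x) \<longlonglongrightarrow> f x"
      unfolding gauss_def by (subst AE_density) (auto elim: eventually_mono)
  qed
qed

text \<open>Both norms are also written as integrals over the joint law, so that all limits are
  taken on one probability space. They become norms over \<open>gauss\<close> in the proof of
  Nelson's theorem.\<close>

definition hypercontractive_pair :: "real \<Rightarrow> (real ^ 'n \<Rightarrow> real) \<Rightarrow> (real ^ 'n \<Rightarrow> real) \<Rightarrow> bool" where
  "hypercontractive_pair r f g \<longleftrightarrow> \<bar>\<integral>w. f (fst w) * g (snd w) \<partial>mehler_joint r\<bar>
    \<le> (\<integral>w. \<bar>f (fst w)\<bar> powr (1 + r\<^sup>2) \<partial>mehler_joint r) powr (1 / (1 + r\<^sup>2))
      * sqrt (\<integral>w. (g (snd w))\<^sup>2 \<partial>mehler_joint r)"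

text \<open>Both marginals are \<open>gauss\<close>, so almost everywhere convergence lifts to the
  joint law, where the uniform bounds yield constant dominating functions.\<close>

lemma hypercontractive_pair_limit:
  fixes f g :: "real ^ 'n \<Rightarrow> real"
  assumes t: "t > 0"
    and f: "\<And>n. h n \<in> borel_measurable borel" "f \<in> borel_measurable borel"
      "\<And>n x. \<bar>h n x\<bar> \<le> B" "AE x in gauss. (\<lambda>n. h n x) \<longlonglongrightarrow> f x"
    and g: "\<And>n. k n \<in> borel_measurable borel" "g \<in> borel_measurable borel"
      "\<And>n x. \<bar>k n x\<bar> \<le> C" "AE x in gauss. (\<lambda>n. k n x) \<longlonglongrightarrow> g x"
    and hc: "\<And>n. hypercontractive_pair (exp (- t)) (h n) (k n)"
  shows "hypercontractive_pair (exp (- t)) f g"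
proof -
  let ?r = "exp (- t)"
  let ?p = "1 + ?r\<^sup>2"
  let ?M = "mehler_joint ?r :: ((real ^ 'n) \<times> (real ^ 'n)) measure"
  interpret prob_space ?M by (rule prob_space_mehler_joint)
  have p: "?p > 0" by (simp add: add_pos_nonneg)
  note [measurable] = f(1,2) g(1,2)
  have F: "AE w in ?M. (\<lambda>n. h n (fst w)) \<longlonglongrightarrow> f (fst w)"
    using f(4) unfolding mehler_joint_fst[OF t, symmetric] by (rule AE_distrD[rotated]) measurable
  have G: "AE w in ?M. (\<lambda>n. k n (snd w)) \<longlonglongrightarrow> g (snd w)"
    using g(4) unfolding mehler_joint_snd[of ?r, symmetric] by (rule AE_distrD[rotated]) measurable
  have C0: "0 \<le> B" "0 \<le> C" using f(3)[of 0 0] g(3)[of 0 0] by linarith+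
  have 1: "(\<lambda>n. \<integral>w. h n (fst w) * k n (snd w) \<partial>?M) \<longlonglongrightarrow> (\<integral>w. f (fst w) * g (snd w) \<partial>?M)"
  proof (rule integral_dominated_convergence[where w = "\<lambda>_. B * C"])
    show "AE w in ?M. (\<lambda>n. h n (fst w) * k n (snd w)) \<longlonglongrightarrow> f (fst w) * g (snd w)"
      using F G by eventually_elim (rule tendsto_mult)
    show "AE w in ?M. norm (h n (fst w) * k n (snd w)) \<le> B * C" for n
      using f(3) g(3) C0 by (auto simp: abs_mult intro!: AE_I2 mult_mono)
  qed auto
  have 2: "(\<lambda>n. \<integral>w. \<bar>h n (fst w)\<bar> powr ?p \<partial>?M) \<longlonglongrightarrow> (\<integral>w. \<bar>f (fst w)\<bar> powr ?p \<partial>?M)"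
  proof (rule integral_dominated_convergence[where w = "\<lambda>_. B powr ?p"])
    show "AE w in ?M. (\<lambda>n. \<bar>h n (fst w)\<bar> powr ?p) \<longlonglongrightarrow> \<bar>f (fst w)\<bar> powr ?p"
      using F by eventually_elim (use p in \<open>auto intro!: tendsto_powr' tendsto_intros\<close>)
    show "AE w in ?M. norm (\<bar>h n (fst w)\<bar> powr ?p) \<le> B powr ?p" for n
      using f(3) p by (auto intro!: AE_I2 powr_mono2)
  qed auto
  have 3: "(\<lambda>n. \<integral>w. (k n (snd w))\<^sup>2 \<partial>?M) \<longlonglongrightarrow> (\<integral>w. (g (snd w))\<^sup>2 \<partial>?M)"
  proof (rule integral_dominated_convergence[where w = "\<lambda>_. C\<^sup>2"])
    show "AE w in ?M. (\<lambda>n. (k n (snd w))\<^sup>2) \<longlonglongrightarrow> (g (snd w))\<^sup>2"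
      using G by eventually_elim (rule tendsto_power)
    show "AE w in ?M. norm ((k n (snd w))\<^sup>2) \<le> C\<^sup>2" for n
      using g(3) C0 by (auto intro!: AE_I2 simp: abs_le_square_iff[symmetric])
  qed auto
  show ?thesis
    unfolding hypercontractive_pair_def
  proof (rule LIMSEQ_le[OF tendsto_rabs[OF 1]])
    show "(\<lambda>n. (\<integral>w. \<bar>h n (fst w)\<bar> powr ?p \<partial>?M) powr (1 / ?p) * sqrt (\<integral>w. (k n (snd w))\<^sup>2 \<partial>?M))
      \<longlonglongrightarrow> (\<integral>w. \<bar>f (fst w)\<bar> powr ?p \<partial>?M) powr (1 / ?p) * sqrt (\<integral>w. (g (snd w))\<^sup>2 \<partial>?M)"
      using p by (intro tendsto_mult tendsto_real_sqrt tendsto_powr' tendsto_const 2 3) auto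
    show "\<exists>N. \<forall>n\<ge>N. \<bar>\<integral>w. h n (fst w) * k n (snd w) \<partial>?M\<bar>
      \<le> (\<integral>w. \<bar>h n (fst w)\<bar> powr ?p \<partial>?M) powr (1 / ?p) * sqrt (\<integral>w. (k n (snd w))\<^sup>2 \<partial>?M)"
      using hc unfolding hypercontractive_pair_def by auto
  qed
qed

lemma hypercontractive_bounded:
  fixes f g :: "real ^ 'n \<Rightarrow> real"
  assumes t: "t > 0"
    and f: "f \<in> borel_measurable borel" "\<And>x. \<bar>f x\<bar> \<le> B"
    and g: "g \<in> borel_measurable borel" "\<And>x. \<bar>g x\<bar> \<le> C"
  shows "hypercontractive_pair (exp (- t)) f g"
proof -
  let ?r = "exp (- t)"
  have r: "0 < ?r" "?r \<le> 1" using t by auto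
  \<comment> \<open>The limit lemma is used twice: from almost periodic to continuous functions
    here, from continuous to Borel functions afterwards.\<close>
  have cont: "hypercontractive_pair ?r f g"
    if f: "continuous_on UNIV f" "\<And>x. \<bar>f x\<bar> \<le> B" and g: "continuous_on UNIV g" "\<And>x. \<bar>g x\<bar> \<le> C"
    for f g :: "real ^ 'n \<Rightarrow> real"
  proof -
    obtain h where h: "\<And>n. almost_periodic (h n)" "\<And>n x. \<bar>h n x\<bar> \<le> B" "\<And>x. (\<lambda>n. h n x) \<longlonglongrightarrow> f x"
      using bounded_continuous_imp_almost_periodic_limit[OF f] by blast
    obtain k where k: "\<And>n. almost_periodic (k n)" "\<And>n x. \<bar>k n x\<bar> \<le> C" "\<And>x. (\<lambda>n. k n x) \<longlonglongrightarrow> g x"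
      using bounded_continuous_imp_almost_periodic_limit[OF g] by blast
    show ?thesis
    proof (rule hypercontractive_pair_limit[OF t])
      show "hypercontractive_pair ?r (h n) (k n)" for n
        unfolding hypercontractive_pair_def by (rule hypercontractive_almost_periodic[OF r h(1) k(1)])
      show "AE x in gauss. (\<lambda>n. h n x) \<longlonglongrightarrow> f x" "AE x in gauss. (\<lambda>n. k n x) \<longlonglongrightarrow> g x"
        using h k by auto
    qed (use h k f g in \<open>auto intro!: borel_measurable_continuous_onI almost_periodic_continuous\<close>)
  qed
  obtain h where h: "\<And>n. continuous_on UNIV (h n)" "\<And>n x. \<bar>h n x\<bar> \<le> B" "AE x in gauss. (\<lambda>n. h n x) \<longlonglongrightarrow> f x"
    using bounded_borel_imp_continuous_limit[OF f] by blast
  obtain k where k: "\<And>n. continuous_on UNIV (k n)" "\<And>n x. \<bar>k n x\<bar> \<le> C" "AE x in gauss. (\<lambda>n. k n x) \<longlonglongrightarrow> g x"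
    using bounded_borel_imp_continuous_limit[OF g] by blast
  show ?thesis
  proof (rule hypercontractive_pair_limit[OF t])
    show "hypercontractive_pair ?r (h n) (k n)" for n by (rule cont[OF h(1,2) k(1,2)])
  qed (use h k f g in \<open>auto intro!: borel_measurable_continuous_onI\<close>)
qed

text \<open>The semigroup on real functions, written as an expectation under the transition
  probability so that Hoelder's inequality applies at each \<open>x\<close>.\<close>

definition ou :: "real \<Rightarrow> (real ^ 'n \<Rightarrow> real) \<Rightarrow> real ^ 'n \<Rightarrow> real" where
  "ou t f x = (\<integral>y. f y \<partial>density gauss (\<lambda>y. ennreal (mehler_kernel t x y)))"

lemma prob_space_mehler_kernel:
  fixes x :: "real ^ 'n"
  assumes t: "t > 0"
  shows "prob_space (density gauss (\<lambda>y. ennreal (mehler_kernel t x y)))"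
  by (rule prob_spaceI) (simp add: emeasure_density nn_integral_mehler_kernel[OF t])

lemma ennreal_ou:
  fixes f :: "real ^ 'n \<Rightarrow> real"
  assumes t: "t > 0" and [measurable]: "f \<in> borel_measurable borel" and f: "\<And>x. 0 \<le> f x" "\<And>x. f x \<le> B"
  shows "ennreal (ou t f x) = (\<integral>\<^sup>+ y. ennreal (mehler_kernel t x y) * ennreal (f y) \<partial>gauss)"
proof -
  interpret prob_space "density gauss (\<lambda>y. ennreal (mehler_kernel t x y))"
    by (rule prob_space_mehler_kernel[OF t])
  have "integrable (density gauss (\<lambda>y. ennreal (mehler_kernel t x y))) f"
    using f by (intro integrable_const_bound[where B=B]) auto
  then have "ennreal (ou t f x) = (\<integral>\<^sup>+ y. ennreal (f y) \<partial>density gauss (\<lambda>y. ennreal (mehler_kernel t x y)))"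
    unfolding ou_def using f by (intro nn_integral_eq_integral[symmetric]) auto
  then show ?thesis by (simp add: nn_integral_density)
qed

lemma ou_bounds:
  fixes f :: "real ^ 'n \<Rightarrow> real"
  assumes t: "t > 0" and [measurable]: "f \<in> borel_measurable borel" and f: "\<And>x. 0 \<le> f x" "\<And>x. f x \<le> B"
  shows "0 \<le> ou t f x" "ou t f x \<le> B"
proof -
  interpret prob_space "density gauss (\<lambda>y. ennreal (mehler_kernel t x y))"
    by (rule prob_space_mehler_kernel[OF t])
  have "integrable (density gauss (\<lambda>y. ennreal (mehler_kernel t x y))) f"
    using f by (intro integrable_const_bound[where B=B]) auto
  then show "0 \<le> ou t f x" "ou t f x \<le> B"
    unfolding ou_def using f by (auto intro!: integral_nonneg_AE integral_le_const)
qed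

lemma sigma_finite_gauss: "sigma_finite_measure (gauss :: (real ^ 'n) measure)"
  using prob_space_gauss prob_space_imp_sigma_finite by blast

lemma borel_measurable_ou [measurable]:
  fixes f :: "real ^ 'n \<Rightarrow> real"
  assumes t: "t > 0" and [measurable]: "f \<in> borel_measurable borel" and f: "\<And>x. 0 \<le> f x" "\<And>x. f x \<le> B"
  shows "ou t f \<in> borel_measurable borel"
proof -
  interpret sigma_finite_measure "gauss :: (real ^ 'n) measure" by (rule sigma_finite_gauss)
  have "ou t f = (\<lambda>x. enn2real (\<integral>\<^sup>+ y. ennreal (mehler_kernel t x y) * ennreal (f y) \<partial>gauss))"
    using ou_bounds(1)[OF assms] by (simp add: fun_eq_iff ennreal_ou[OF assms, symmetric])
  also have "\<dots> \<in> borel_measurable borel" by measurable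
  finally show ?thesis .
qed

text \<open>Self-testing with \<open>g = ou t f\<close>: integrating out \<open>y\<close> at fixed
  \<open>x\<close> turns the left side of the bilinear inequality into the squared norm
  \<open>I\<close> of \<open>ou t f\<close>. Hence \<open>I \<le> A * sqrt I\<close>, and one factor
  cancels.\<close>

lemma nelson_hypercontractivity:
  fixes f :: "real ^ 'n \<Rightarrow> real"
  assumes t: "t > 0" and f[measurable]: "f \<in> borel_measurable borel" and bd: "\<And>x. 0 \<le> f x" "\<And>x. f x \<le> B"
  shows "sqrt (\<integral>x. (ou t f x)\<^sup>2 \<partial>gauss) \<le> (\<integral>x. f x powr (1 + exp (- 2 * t)) \<partial>gauss) powr (1 / (1 + exp (- 2 * t)))"
proof -
  let ?r = "exp (- t)"
  let ?M = "mehler_joint ?r :: ((real ^ 'n) \<times> (real ^ 'n)) measure"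
  interpret M: prob_space ?M by (rule prob_space_mehler_joint)
  interpret G: prob_space "gauss :: (real ^ 'n) measure" by (rule prob_space_gauss)
  have r2: "?r\<^sup>2 = exp (- 2 * t)" by (simp add: power2_eq_square exp_add[symmetric])
  note P = ou_bounds[OF assms]
  note [measurable] = borel_measurable_ou[OF assms]
  have B0: "0 \<le> B" using bd[of 0] by linarith
  define I where "I = (\<integral>x. (ou t f x)\<^sup>2 \<partial>gauss)"
  define A where "A = (\<integral>x. f x powr (1 + exp (- 2 * t)) \<partial>gauss) powr (1 / (1 + exp (- 2 * t)))"
  have I0: "0 \<le> I" unfolding I_def by simp
  have "\<bar>\<integral>w. f (fst w) * ou t f (snd w) \<partial>?M\<bar>
    \<le> (\<integral>w. \<bar>f (fst w)\<bar> powr (1 + ?r\<^sup>2) \<partial>?M) powr (1 / (1 + ?r\<^sup>2)) * sqrt (\<integral>w. (ou t f (snd w))\<^sup>2 \<partial>?M)"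
    using hypercontractive_bounded[OF t f, of B "ou t f" B] P bd unfolding hypercontractive_pair_def by auto
  also have "(\<integral>w. \<bar>f (fst w)\<bar> powr (1 + ?r\<^sup>2) \<partial>?M) = (\<integral>x. \<bar>f x\<bar> powr (1 + ?r\<^sup>2) \<partial>distr ?M borel fst)"
    by (subst integral_distr) auto
  also have "(\<integral>w. (ou t f (snd w))\<^sup>2 \<partial>?M) = (\<integral>x. (ou t f x)\<^sup>2 \<partial>distr ?M borel snd)"
    by (subst integral_distr) auto
  finally have 1: "\<bar>\<integral>w. f (fst w) * ou t f (snd w) \<partial>?M\<bar> \<le> A * sqrt I"
    unfolding mehler_joint_fst[OF t] mehler_joint_snd r2 I_def A_def using bd by (simp add: abs_of_nonneg)
  have "ennreal (\<integral>w. f (fst w) * ou t f (snd w) \<partial>?M) = (\<integral>\<^sup>+ w. ennreal (f (fst w) * ou t f (snd w)) \<partial>?M)"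
    using bd P B0 by (intro nn_integral_eq_integral[symmetric] M.integrable_const_bound[where B="B * B"])
      (auto intro!: AE_I2 mult_mono simp: abs_mult)
  also have "\<dots> = (\<integral>\<^sup>+ x. (\<integral>\<^sup>+ y. ennreal (mehler_kernel t x y) * ennreal (f y * ou t f x) \<partial>gauss) \<partial>gauss)"
    by (subst nn_integral_mehler_joint[OF t]) auto
  also have "\<dots> = (\<integral>\<^sup>+ x. ennreal (ou t f x) * ennreal (ou t f x) \<partial>gauss)"
  proof (rule nn_integral_cong)
    fix x :: "real ^ 'n"
    have "(\<integral>\<^sup>+ y. ennreal (mehler_kernel t x y) * ennreal (f y * ou t f x) \<partial>gauss)
      = (\<integral>\<^sup>+ y. ennreal (mehler_kernel t x y) * ennreal (f y) * ennreal (ou t f x) \<partial>gauss)"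
      using bd P by (intro nn_integral_cong) (simp add: ennreal_mult mult.assoc)
    also have "\<dots> = (\<integral>\<^sup>+ y. ennreal (mehler_kernel t x y) * ennreal (f y) \<partial>gauss) * ennreal (ou t f x)"
      by (rule nn_integral_multc) auto
    finally show "(\<integral>\<^sup>+ y. ennreal (mehler_kernel t x y) * ennreal (f y * ou t f x) \<partial>gauss)
      = ennreal (ou t f x) * ennreal (ou t f x)"
      by (simp only: ennreal_ou[OF assms])
  qed
  also have "\<dots> = (\<integral>\<^sup>+ x. ennreal ((ou t f x)\<^sup>2) \<partial>gauss)"
    using P by (simp add: ennreal_mult power2_eq_square)
  also have "\<dots> = ennreal I"
    unfolding I_def using P B0 by (intro nn_integral_eq_integral G.integrable_const_bound[where B="B\<^sup>2"])
      (auto intro!: AE_I2 power_mono)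
  finally have "(\<integral>w. f (fst w) * ou t f (snd w) \<partial>?M) = I"
    using I0 bd P by (subst (asm) ennreal_inj) (auto intro!: integral_nonneg_AE)
  with 1 have "I \<le> A * sqrt I" by simp
  then have *: "sqrt I * sqrt I \<le> A * sqrt I" using I0 by simp
  \<comment> \<open>Cancelling \<open>sqrt I\<close> presupposes \<open>I > 0\<close>; for
    \<open>I = 0\<close> the claim is just \<open>0 \<le> A\<close>.\<close>
  have "0 \<le> A" by (simp add: A_def)
  then have "sqrt I \<le> A"
    using * I0 mult_right_le_imp_le[of "sqrt I" "sqrt I" A] by (cases "I = 0") auto
  then show ?thesis by (simp add: I_def A_def)
qed

section \<open>Interpolation\<close>

text \<open>Hoelder's inequality for the exponents \<open>1 / (1 - \<theta>)\<close> and
  \<open>1 / \<theta>\<close>, in a form that includes the endpoints. After normalizing both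
  integrals to 1 it is the weighted arithmetic-geometric mean inequality integrated.\<close>

lemma integral_powr_interpolation:
  fixes f g :: "'a \<Rightarrow> real"
  assumes f: "integrable M f" "\<And>x. 0 \<le> f x" and g: "integrable M g" "\<And>x. 0 \<le> g x"
    and \<theta>: "0 \<le> \<theta>" "\<theta> \<le> 1"
  shows "(\<integral>x. f x powr (1 - \<theta>) * g x powr \<theta> \<partial>M)
    \<le> (\<integral>x. f x \<partial>M) powr (1 - \<theta>) * (\<integral>x. g x \<partial>M) powr \<theta>"
proof (cases "(\<integral>x. f x \<partial>M) = 0 \<or> (\<integral>x. g x \<partial>M) = 0")
  case True
  \<comment> \<open>Since \<open>0 powr 0 = 0\<close>, the right side vanishes in this case even at
    an endpoint \<open>\<theta>\<close>; by the same convention so does the integrand on the left,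
    almost everywhere.\<close>
  then have "(AE x in M. f x = 0) \<or> (AE x in M. g x = 0)"
    using f g integral_nonneg_eq_0_iff_AE[of M f] integral_nonneg_eq_0_iff_AE[of M g] by auto
  then have "AE x in M. f x powr (1 - \<theta>) * g x powr \<theta> = 0" by (auto elim!: eventually_mono)
  then have "(\<integral>x. f x powr (1 - \<theta>) * g x powr \<theta> \<partial>M) = 0"
    by (rule integral_eq_zero_AE)
  then show ?thesis by simp
next
  case False
  define A where "A = (\<integral>x. f x \<partial>M)"
  define B where "B = (\<integral>x. g x \<partial>M)"
  have A: "0 < A" and B: "0 < B"
    using False f g by (auto simp: A_def B_def less_le intro!: integral_nonneg_AE)
  have le: "f x powr (1 - \<theta>) * g x powr \<theta> \<le> A powr (1 - \<theta>) * B powr \<theta> * ((1 - \<theta>) * (f x / A) + \<theta> * (g x / B))" for x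
  proof (cases "f x = 0 \<or> g x = 0")
    case True
    then have "f x powr (1 - \<theta>) * g x powr \<theta> = 0" by auto
    moreover have "0 \<le> A powr (1 - \<theta>) * B powr \<theta> * ((1 - \<theta>) * (f x / A) + \<theta> * (g x / B))"
      using f(2)[of x] g(2)[of x] A B \<theta> by (intro mult_nonneg_nonneg add_nonneg_nonneg) auto
    ultimately show ?thesis by linarith
  next
    case False
    then have pos: "0 < f x" "0 < g x" using f(2)[of x] g(2)[of x] by (auto simp: less_le)
    have "f x powr (1 - \<theta>) * g x powr \<theta> = A powr (1 - \<theta>) * B powr \<theta> * ((f x / A) powr (1 - \<theta>) * (g x / B) powr \<theta>)"
      using A B by (simp add: powr_divide)
    also have "\<dots> \<le> A powr (1 - \<theta>) * B powr \<theta> * ((1 - \<theta>) * (f x / A) + \<theta> * (g x / B))"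
      using pos A B \<theta> by (intro mult_left_mono Youngs_inequality_0) auto
    finally show ?thesis .
  qed
  let ?h = "\<lambda>x. A powr (1 - \<theta>) * B powr \<theta> * ((1 - \<theta>) * (f x / A) + \<theta> * (g x / B))"
  have int: "integrable M ?h" using f(1) g(1) by simp
  have "(\<integral>x. f x powr (1 - \<theta>) * g x powr \<theta> \<partial>M) \<le> (\<integral>x. ?h x \<partial>M)"
  proof (rule integral_mono'[OF int])
    show "f x powr (1 - \<theta>) * g x powr \<theta> \<le> ?h x" for x by (rule le)
    show "0 \<le> ?h x" for x by (rule order_trans[OF _ le]) simp
  qed
  also have "\<dots> = A powr (1 - \<theta>) * B powr \<theta> * ((1 - \<theta>) * (A / A) + \<theta> * (B / B))"
    using f(1) g(1) by (simp add: A_def B_def)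
  also have "\<dots> = A powr (1 - \<theta>) * B powr \<theta>" using A B by simp
  finally show ?thesis by (simp add: A_def B_def)
qed

text \<open>Monotonicity puts each mixed product below the diagonal one at \<open>max j k\<close>.
  This pulls the square through the limit of truncations.\<close>

lemma SUP_mult_self_le:
  fixes X :: "nat \<Rightarrow> ennreal"
  assumes "incseq X"
  shows "(SUP k. X k) * (SUP k. X k) \<le> (SUP k. X k * X k)"
proof -
  have "(SUP k. X k) * (SUP k. X k) = (SUP j. SUP k. X k * X j)"
    by (simp add: SUP_mult_left_ennreal SUP_mult_right_ennreal)
  also have "\<dots> \<le> (SUP k. X k * X k)"
  proof (intro SUP_least)
    fix j k
    have "X k * X j \<le> X (max j k) * X (max j k)"
      by (intro mult_mono incseqD[OF assms]) auto
    then show "X k * X j \<le> (SUP k. X k * X k)" by (rule SUP_upper2[rotated]) simp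
  qed
  finally show ?thesis .
qed

lemma Lp_norm_eq_integral:
  assumes "integrable M (\<lambda>x. norm (u x) powr p)"
  shows "Lp_norm p M u = ennreal ((\<integral>x. norm (u x) powr p \<partial>M) powr (1 / p))"
proof -
  have "(\<integral>\<^sup>+ x. ennreal (norm (u x) powr p) \<partial>M) = ennreal (\<integral>x. norm (u x) powr p \<partial>M)"
    using assms by (intro nn_integral_eq_integral) auto
  then show ?thesis by (simp add: Lp_norm_def)
qed

lemma OU_semigroup_of_real:
  fixes f :: "real ^ 'n \<Rightarrow> real"
  assumes [measurable]: "f \<in> borel_measurable borel"
  shows "OU_semigroup t (\<lambda>x. complex_of_real (f x)) x = complex_of_real (ou t f x)"
proof -
  have "ou t f x = (\<integral>y. mehler_kernel t x y * f y \<partial>gauss)"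
    unfolding ou_def by (subst integral_density) (auto simp: mehler_kernel_nonneg)
  then show ?thesis
    unfolding OU_semigroup_def by (simp only: of_real_mult[symmetric] integral_complex_of_real)
qed

text \<open>Hoelder's inequality is used twice: in \<open>y\<close> for the pointwise bound, then in
  \<open>x\<close> to separate the two squares. The assumed \<open>L^2\<close> bound controls
  \<open>f0\<close> and Nelson's theorem controls \<open>f1\<close>; both bounds are expressed by
  the single integral \<open>J\<close>.\<close>

lemma interpolated_offdiag:
  fixes f :: "real ^ 'n \<Rightarrow> real"
  assumes t: "t > 0" and p: "1 + exp (- 2 * t) < p" "p \<le> 2"
    and f[measurable]: "f \<in> borel_measurable borel" and bd: "\<And>x. 0 \<le> f x" "\<And>x. f x \<le> B"
    and F[measurable]: "F \<in> sets borel" and a: "0 < a"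
    and \<theta>: "0 \<le> \<theta>" "\<theta> \<le> 1" "(1 - \<theta>) / 2 + \<theta> / (1 + exp (- 2 * t)) = 1 / p"
    and L2: "sqrt (\<integral>x. indicator F x * (ou t (\<lambda>x. f x powr (p / 2)) x)\<^sup>2 \<partial>gauss)
      \<le> a * sqrt (\<integral>x. (f x powr (p / 2))\<^sup>2 \<partial>gauss)"
  shows "(\<integral>x. indicator F x * (ou t f x)\<^sup>2 \<partial>gauss)
    \<le> (a powr (1 - \<theta>))\<^sup>2 * (\<integral>x. f x powr p \<partial>gauss) powr (2 / p)"
proof -
  define q where "q = 1 + exp (- 2 * t)"
  have q: "1 < q" "q < p" using p by (auto simp: q_def)
  define f0 where "f0 x = f x powr (p / 2)" for x
  define f1 where "f1 x = f x powr (p / q)" for x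
  have B0: "0 \<le> B" using bd[of 0] by linarith
  have m[measurable]: "f0 \<in> borel_measurable borel" "f1 \<in> borel_measurable borel"
    unfolding f0_def f1_def by measurable
  have b0: "0 \<le> f0 x" "f0 x \<le> B powr (p / 2)" for x
    using bd p q by (auto simp: f0_def intro!: powr_mono2)
  have b1: "0 \<le> f1 x" "f1 x \<le> B powr (p / q)" for x
    using bd p q by (auto simp: f1_def intro!: powr_mono2)
  interpret G: prob_space "gauss :: (real ^ 'n) measure" by (rule prob_space_gauss)
  note [measurable] = borel_measurable_ou[OF t f bd] borel_measurable_ou[OF t m(1) b0] borel_measurable_ou[OF t m(2) b1]
  note P = ou_bounds[OF t f bd] and P0 = ou_bounds[OF t m(1) b0] and P1 = ou_bounds[OF t m(2) b1]
  define J where "J = (\<integral>x. f x powr p \<partial>gauss)"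
  have ee: "(1 - \<theta>) / 2 + \<theta> / q = 1 / p" using \<theta>(3) by (simp add: q_def)
  have f_eq: "f x = f0 x powr (1 - \<theta>) * f1 x powr \<theta>" for x
  proof -
    have "f0 x powr (1 - \<theta>) * f1 x powr \<theta> = f x powr (p * ((1 - \<theta>) / 2 + \<theta> / q))"
      by (simp add: f0_def f1_def powr_powr powr_add[symmetric] algebra_simps)
    then show ?thesis using bd[of x] p q by (simp add: ee)
  qed
  have pw: "ou t f x \<le> ou t f0 x powr (1 - \<theta>) * ou t f1 x powr \<theta>" for x
  proof -
    interpret D: prob_space "density gauss (\<lambda>y. ennreal (mehler_kernel t x y))"
      by (rule prob_space_mehler_kernel[OF t])
    have "ou t f x = (\<integral>y. f0 y powr (1 - \<theta>) * f1 y powr \<theta> \<partial>density gauss (\<lambda>y. ennreal (mehler_kernel t x y)))"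
      unfolding ou_def by (intro Bochner_Integration.integral_cong refl f_eq)
    also have "\<dots> \<le> ou t f0 x powr (1 - \<theta>) * ou t f1 x powr \<theta>"
      unfolding ou_def using b0 b1 \<theta>
      by (intro integral_powr_interpolation D.integrable_const_bound[where B="B powr (p / 2)"]
          D.integrable_const_bound[where B="B powr (p / q)"]) auto
    finally show ?thesis .
  qed
  have i0: "integrable gauss (\<lambda>x. indicator F x * (ou t f0 x)\<^sup>2)"
    using P0 by (intro G.integrable_const_bound[where B="(B powr (p / 2))\<^sup>2"])
      (auto intro!: AE_I2 power_mono split: split_indicator)
  have i1: "integrable gauss (\<lambda>x. (ou t f1 x)\<^sup>2)"
    using P1 by (intro G.integrable_const_bound[where B="(B powr (p / q))\<^sup>2"])
      (auto intro!: AE_I2 power_mono)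
  have sq: "u powr (2 * c) = (u powr c)\<^sup>2" for u c :: real
    by (simp add: power2_eq_square powr_add[symmetric])
  have "(\<integral>x. indicator F x * (ou t f x)\<^sup>2 \<partial>gauss)
    \<le> (\<integral>x. (indicator F x * (ou t f0 x)\<^sup>2) powr (1 - \<theta>) * ((ou t f1 x)\<^sup>2) powr \<theta> \<partial>gauss)"
  proof (rule integral_mono_AE)
    show "integrable gauss (\<lambda>x. indicator F x * (ou t f x)\<^sup>2)"
      using P B0 by (intro G.integrable_const_bound[where B="B\<^sup>2"])
        (auto intro!: AE_I2 power_mono split: split_indicator)
    show "integrable gauss (\<lambda>x. (indicator F x * (ou t f0 x)\<^sup>2) powr (1 - \<theta>) * ((ou t f1 x)\<^sup>2) powr \<theta>)"
      using P0 P1 \<theta>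
      by (intro G.integrable_const_bound[where B="((B powr (p / 2))\<^sup>2) powr (1 - \<theta>) * ((B powr (p / q))\<^sup>2) powr \<theta>"])
        (auto intro!: AE_I2 mult_mono powr_mono2 power_mono simp: abs_mult split: split_indicator)
    have "indicator F x * (ou t f x)\<^sup>2 \<le> (indicator F x * (ou t f0 x)\<^sup>2) powr (1 - \<theta>) * ((ou t f1 x)\<^sup>2) powr \<theta>" for x
    proof (cases "x \<in> F")
      case True
      have "(ou t f x)\<^sup>2 \<le> (ou t f0 x powr (1 - \<theta>) * ou t f1 x powr \<theta>)\<^sup>2"
        using pw P by (intro power_mono)
      also have "\<dots> = ((ou t f0 x)\<^sup>2) powr (1 - \<theta>) * ((ou t f1 x)\<^sup>2) powr \<theta>"
        by (simp add: power2_eq_square powr_mult P0 P1)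
      finally show ?thesis using True by simp
    qed simp
    then show "AE x in gauss. indicator F x * (ou t f x)\<^sup>2
        \<le> (indicator F x * (ou t f0 x)\<^sup>2) powr (1 - \<theta>) * ((ou t f1 x)\<^sup>2) powr \<theta>" by simp
  qed
  also have "\<dots> \<le> (\<integral>x. indicator F x * (ou t f0 x)\<^sup>2 \<partial>gauss) powr (1 - \<theta>) * (\<integral>x. (ou t f1 x)\<^sup>2 \<partial>gauss) powr \<theta>"
    using \<theta> i0 i1 by (intro integral_powr_interpolation) auto
  also have "\<dots> \<le> (a\<^sup>2 * J) powr (1 - \<theta>) * ((J powr (1 / q))\<^sup>2) powr \<theta>"
  proof (intro mult_mono powr_mono2)
    have "(\<integral>x. (f x powr (p / 2))\<^sup>2 \<partial>gauss) = J"
      unfolding J_def by (simp add: sq[symmetric])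
    then have "sqrt (\<integral>x. indicator F x * (ou t f0 x)\<^sup>2 \<partial>gauss) \<le> sqrt (a\<^sup>2 * J)"
      using L2 a unfolding f0_def by (simp add: real_sqrt_mult)
    then show "(\<integral>x. indicator F x * (ou t f0 x)\<^sup>2 \<partial>gauss) \<le> a\<^sup>2 * J" by simp
    have "(\<integral>x. f1 x powr q \<partial>gauss) = J"
      unfolding J_def f1_def using q by (simp add: powr_powr)
    then have "sqrt (\<integral>x. (ou t f1 x)\<^sup>2 \<partial>gauss) \<le> J powr (1 / q)"
      using nelson_hypercontractivity[OF t m(2) b1] by (simp add: q_def)
    then show "(\<integral>x. (ou t f1 x)\<^sup>2 \<partial>gauss) \<le> (J powr (1 / q))\<^sup>2"
      using sqrt_le_D by blast
  qed (use \<theta> in \<open>auto intro!: integral_nonneg_AE\<close>)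
  also have "\<dots> = (a powr (1 - \<theta>))\<^sup>2 * J powr (2 / p)"
  proof -
    have "(a\<^sup>2 * J) powr (1 - \<theta>) * ((J powr (1 / q))\<^sup>2) powr \<theta>
      = (a\<^sup>2) powr (1 - \<theta>) * (J powr (1 - \<theta>) * (J powr (2 * (1 / q))) powr \<theta>)"
      unfolding sq by (simp add: powr_mult)
    also have "(a\<^sup>2) powr (1 - \<theta>) = (a powr (1 - \<theta>))\<^sup>2"
      by (simp add: power2_eq_square powr_mult)
    also have "J powr (1 - \<theta>) * (J powr (2 * (1 / q))) powr \<theta> = J powr (2 * ((1 - \<theta>) / 2 + \<theta> / q))"
    proof -
      \<comment> \<open>The exponents of \<open>J\<close> from the two factors add up to
        \<open>2 / p\<close> by the relation that determines \<open>\<theta>\<close>.\<close>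
      have "(1 - \<theta>) + 2 * (1 / q) * \<theta> = 2 * ((1 - \<theta>) / 2 + \<theta> / q)"
        using q by (simp add: field_simps)
      then show ?thesis by (simp only: powr_powr powr_add[symmetric])
    qed
    finally show ?thesis by (simp add: ee)
  qed
  finally show ?thesis by (simp add: J_def)
qed

text \<open>Positivity of the kernel reduces the claim to \<open>|1_E u|\<close>. Truncating at
  height \<open>k\<close> brings it within reach of the interpolated bound; the resulting
  \<open>R\<close> does not depend on \<open>k\<close>, so monotone convergence removes the
  truncation.\<close>

theorem theorem2p3:
  fixes t p C :: real and E F :: "(real ^ 'n) set"
  assumes "t > 0"
    and "1 + exp (- 2 * t) < p" and "p \<le> 2"
    and "C > 0"
    and mcintosh: "\<And>(E' :: (real ^ 'n) set) F' v.
      E' \<in> sets borel \<Longrightarrow> F' \<in> sets borel \<Longrightarrow> v \<in> Lp_fun 2 gauss \<Longrightarrow>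
      Lp_norm 2 gauss (cutoff F' (OU_semigroup t (cutoff E' v)))
        \<le> offdiag_rhs E' F'
            (C * (t / setdist E' F') * exp (- (setdist E' F')\<^sup>2 / (2 * t)))
            (Lp_norm 2 gauss (cutoff E' v))"
    and "E \<in> sets borel" and "F \<in> sets borel"
  shows "0 \<le> delta p t \<and> delta p t < 1 \<and>
    (\<forall>u \<in> Lp_fun p gauss.
      Lp_norm 2 gauss (cutoff F (OU_semigroup t (cutoff E u)))
        \<le> offdiag_rhs E F
            ((C * t / setdist E F * exp (- (setdist E F)\<^sup>2 / (2 * t))) powr (1 - delta p t))
            (Lp_norm p gauss (cutoff E u)))"
proof -
  let ?\<theta> = "delta p t"
  define q where "q = 1 + exp (- 2 * t)"
  have t: "t > 0" and p: "1 + exp (- 2 * t) < p" "p \<le> 2" by fact+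
  have [measurable]: "E \<in> sets borel" "F \<in> sets borel" by fact+
  have q: "1 < q" "q < p" using p by (auto simp: q_def)
  have d: "?\<theta> = (1 / p - 1 / 2) / (1 / q - 1 / 2)"
    unfolding delta_def q_def by (metis minus_diff_eq minus_divide_divide)
  \<comment> \<open>\<open>delta p t\<close> is the position of \<open>1 / p\<close> on the way from
    \<open>1 / 2\<close> to \<open>1 / q\<close>: \<open>p \<le> 2\<close> makes it nonnegative,
    \<open>q < p\<close> keeps it below 1.\<close>
  have lt: "1 / 2 \<le> 1 / p" "1 / p < 1 / q" using q p by (auto simp: divide_simps)
  have ne: "1 / q - 1 / 2 \<noteq> 0" using lt by linarith
  have \<theta>: "0 \<le> ?\<theta>" "?\<theta> < 1"
    unfolding d using lt by auto
  have "?\<theta> * (1 / q - 1 / 2) = 1 / p - 1 / 2"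
    unfolding d using ne by (simp only: times_divide_eq_left nonzero_mult_div_cancel_right not_False_eq_True)
  then have ee: "(1 - ?\<theta>) / 2 + ?\<theta> / (1 + exp (- 2 * t)) = 1 / p"
    unfolding q_def by (simp add: algebra_simps diff_divide_distrib)
  have "Lp_norm 2 gauss (cutoff F (OU_semigroup t (cutoff E u)))
        \<le> offdiag_rhs E F
            ((C * t / setdist E F * exp (- (setdist E F)\<^sup>2 / (2 * t))) powr (1 - ?\<theta>))
            (Lp_norm p gauss (cutoff E u))" if u: "u \<in> Lp_fun p gauss" for u
  proof (cases "E = {} \<or> F = {} \<or> setdist E F = 0")
    case True
    \<comment> \<open>An empty set makes both sides 0; nonempty sets at distance 0 make the right
      side infinite.\<close>
    have "cutoff F (OU_semigroup t (cutoff E u)) = (\<lambda>_. 0)" if "E = {} \<or> F = {}"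
      using that by (auto simp: cutoff_def OU_semigroup_def fun_eq_iff)
    moreover have "Lp_norm 2 gauss (\<lambda>_::real ^ 'n. 0) = 0" by (simp add: Lp_norm_def)
    ultimately show ?thesis using True by (auto simp: offdiag_rhs_def)
  next
    case False
    define a where "a = C * t / setdist E F * exp (- (setdist E F)\<^sup>2 / (2 * t))"
    have a: "0 < a" using False t \<open>C > 0\<close> setdist_pos_le[of E F] by (simp add: a_def less_le)
    interpret G: prob_space "gauss :: (real ^ 'n) measure" by (rule prob_space_gauss)
    have "u \<in> borel_measurable gauss" using u by (simp add: Lp_fun_def)
    then have [measurable]: "u \<in> borel_measurable borel" by simp
    define w where "w x = indicator E x * norm (u x)" for x
    have [measurable]: "w \<in> borel_measurable borel" unfolding w_def by measurable
    have w0: "0 \<le> w x" for x by (simp add: w_def)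
    have wn: "norm (cutoff E u x) = w x" for x
      by (simp add: w_def cutoff_def norm_mult split: split_indicator)
    have iw: "integrable gauss (\<lambda>x. w x powr p)"
    proof (rule integrableI_bounded)
      have "(\<integral>\<^sup>+ x. ennreal (norm (u x) powr p) \<partial>gauss) < \<infinity>"
        using u by (auto simp: Lp_fun_def Lp_norm_def Let_def less_top split: if_splits)
      moreover have "(\<integral>\<^sup>+ x. ennreal (norm (w x powr p)) \<partial>gauss) \<le> (\<integral>\<^sup>+ x. ennreal (norm (u x) powr p) \<partial>gauss)"
        by (intro nn_integral_mono) (auto simp: w_def split: split_indicator)
      ultimately show "(\<integral>\<^sup>+ x. ennreal (norm (w x powr p)) \<partial>gauss) < \<infinity>" by (rule le_less_trans[rotated])
    qed measurable
    define J where "J = (\<integral>x. w x powr p \<partial>gauss)"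
    define R where "R = (a powr (1 - ?\<theta>))\<^sup>2 * J powr (2 / p)"
    define f where "f k x = min (w x) (real k)" for k x
    have fm[measurable]: "f k \<in> borel_measurable borel" for k unfolding f_def by measurable
    have fb: "0 \<le> f k x" "f k x \<le> real k" for k x using w0 by (auto simp: f_def)
    have trunc: "(\<integral>x. indicator F x * (ou t (f k) x)\<^sup>2 \<partial>gauss) \<le> R" for k
    proof -
      define f0 where "f0 x = f k x powr (p / 2)" for x
      have m0[measurable]: "f0 \<in> borel_measurable borel" unfolding f0_def by measurable
      have b0: "0 \<le> f0 x" "f0 x \<le> real k powr (p / 2)" for x
        using fb p q by (auto simp: f0_def intro!: powr_mono2)
      note P0 = ou_bounds[OF t m0 b0] and [measurable] = borel_measurable_ou[OF t m0 b0]
      let ?v = "\<lambda>x. complex_of_real (f0 x)"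
      \<comment> \<open>The power \<open>p / 2\<close> of the truncation vanishes off
        \<open>E\<close>, as \<open>0 powr (p / 2) = 0\<close>. The cutoff in the hypothesis
        therefore leaves \<open>?v\<close> unchanged.\<close>
      have cv: "cutoff E ?v = ?v"
        using p q by (auto simp: cutoff_def f0_def f_def w_def fun_eq_iff split: split_indicator)
      have nv: "Lp_norm 2 gauss ?v = ennreal (sqrt (\<integral>x. (f0 x)\<^sup>2 \<partial>gauss))"
      proof (subst Lp_norm_eq_integral)
        show "integrable gauss (\<lambda>x. norm (?v x) powr 2)"
          using b0 by (intro G.integrable_const_bound[where B="(real k powr (p / 2))\<^sup>2"])
            (auto intro!: AE_I2 power_mono)
      qed (simp add: b0 powr_half_sqrt)
      have v: "?v \<in> Lp_fun 2 gauss" unfolding Lp_fun_def using nv by simp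
      have "Lp_norm 2 gauss (cutoff F (OU_semigroup t (cutoff E ?v)))
        \<le> offdiag_rhs E F (C * (t / setdist E F) * exp (- (setdist E F)\<^sup>2 / (2 * t))) (Lp_norm 2 gauss (cutoff E ?v))"
        by (rule mcintosh[OF assms(6,7) v])
      moreover have "cutoff F (OU_semigroup t ?v) = (\<lambda>x. complex_of_real (indicator F x * ou t f0 x))"
        by (auto simp: cutoff_def OU_semigroup_of_real[OF m0] fun_eq_iff split: split_indicator)
      moreover have "Lp_norm 2 gauss (\<lambda>x. complex_of_real (indicator F x * ou t f0 x))
        = ennreal (sqrt (\<integral>x. indicator F x * (ou t f0 x)\<^sup>2 \<partial>gauss))"
      proof (subst Lp_norm_eq_integral)
        have e: "norm (complex_of_real (indicator F x * ou t f0 x)) powr 2 = indicator F x * (ou t f0 x)\<^sup>2" for x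
          using P0 by (auto split: split_indicator)
        show "integrable gauss (\<lambda>x. norm (complex_of_real (indicator F x * ou t f0 x)) powr 2)"
          unfolding e using P0 by (intro G.integrable_const_bound[where B="(real k powr (p / 2))\<^sup>2"])
            (auto intro!: AE_I2 power_mono split: split_indicator)
        show "ennreal ((\<integral>x. norm (complex_of_real (indicator F x * ou t f0 x)) powr 2 \<partial>gauss) powr (1 / 2))
          = ennreal (sqrt (\<integral>x. indicator F x * (ou t f0 x)\<^sup>2 \<partial>gauss))"
          unfolding e by (simp add: powr_half_sqrt integral_nonneg_AE)
      qed
      ultimately have "ennreal (sqrt (\<integral>x. indicator F x * (ou t f0 x)\<^sup>2 \<partial>gauss))
        \<le> ennreal a * ennreal (sqrt (\<integral>x. (f0 x)\<^sup>2 \<partial>gauss))"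
        using False by (simp add: cv nv offdiag_rhs_def a_def)
      then have L2: "sqrt (\<integral>x. indicator F x * (ou t f0 x)\<^sup>2 \<partial>gauss) \<le> a * sqrt (\<integral>x. (f0 x)\<^sup>2 \<partial>gauss)"
        using a by (simp add: ennreal_mult[symmetric])
      have "(\<integral>x. indicator F x * (ou t (f k) x)\<^sup>2 \<partial>gauss)
        \<le> (a powr (1 - ?\<theta>))\<^sup>2 * (\<integral>x. f k x powr p \<partial>gauss) powr (2 / p)"
        using L2 \<theta> unfolding f0_def
        by (intro interpolated_offdiag[OF t p fm fb _ a _ _ ee]) auto
      also have "\<dots> \<le> R"
        unfolding R_def J_def
      proof (intro mult_left_mono powr_mono2 integral_mono_AE iw)
        show "integrable gauss (\<lambda>x. f k x powr p)"
          using fb p q by (intro G.integrable_const_bound[where B="real k powr p"])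
            (auto intro!: AE_I2 powr_mono2)
        show "AE x in gauss. f k x powr p \<le> w x powr p"
          using fb p q by (auto intro!: AE_I2 powr_mono2 simp: f_def w0)
      qed (use p q in \<open>auto intro!: integral_nonneg_AE\<close>)
      finally show ?thesis .
    qed
    \<comment> \<open>The semigroup applied to \<open>|1_E u|\<close>, with values in
      \<open>[0, \<infinity>]\<close>, so that it is the supremum over the truncations without any
      prior integrability.\<close>
    define W where "W x = (\<integral>\<^sup>+ y. ennreal (mehler_kernel t x y) * ennreal (w y) \<partial>gauss)" for x :: "real ^ 'n"
    have fk: "incseq (\<lambda>k. ennreal (f k y))" "(SUP k. ennreal (f k y)) = ennreal (w y)" for y
    proof -
      show inc: "incseq (\<lambda>k. ennreal (f k y))"
        by (auto simp: incseq_def f_def intro!: ennreal_leI)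
      have "(\<lambda>k. ennreal (f k y)) \<longlonglongrightarrow> ennreal (w y)"
      proof (rule tendsto_eventually)
        obtain k0 where "w y \<le> real k0" using real_arch_simple by blast
        then show "\<forall>\<^sub>F k in sequentially. ennreal (f k y) = ennreal (w y)"
          by (intro eventually_sequentiallyI[of k0]) (simp add: f_def min_absorb1)
      qed
      then show "(SUP k. ennreal (f k y)) = ennreal (w y)"
        using LIMSEQ_SUP[OF inc] LIMSEQ_unique by blast
    qed
    have Winc: "incseq (\<lambda>k. ennreal (ou t (f k) x))" for x
      unfolding ennreal_ou[OF t fm fb] incseq_def
      by (auto intro!: nn_integral_mono mult_left_mono incseqD[OF fk(1)])
    have Wsup: "W x = (SUP k. ennreal (ou t (f k) x))" for x
    proof -
      have "W x = (\<integral>\<^sup>+ y. (SUP k. ennreal (mehler_kernel t x y) * ennreal (f k y)) \<partial>gauss)"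
        unfolding W_def fk(2)[symmetric] by (simp add: SUP_mult_left_ennreal)
      also have "\<dots> = (SUP k. \<integral>\<^sup>+ y. ennreal (mehler_kernel t x y) * ennreal (f k y) \<partial>gauss)"
        by (rule nn_integral_monotone_convergence_SUP)
          (auto simp: incseq_def le_fun_def intro!: mult_left_mono incseqD[OF fk(1)])
      finally show ?thesis unfolding ennreal_ou[OF t fm fb] .
    qed
    have OUW: "ennreal (norm (OU_semigroup t (cutoff E u) x)) \<le> W x" for x
    proof -
      \<comment> \<open>If the integrand is not integrable, the Bochner integral is 0 by default and
        the bound is trivial.\<close>
      have "ennreal (norm (OU_semigroup t (cutoff E u) x))
        \<le> (\<integral>\<^sup>+ y. ennreal (norm (complex_of_real (mehler_kernel t x y) * cutoff E u y)) \<partial>gauss)"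
        unfolding OU_semigroup_def
        by (cases "integrable gauss (\<lambda>y. complex_of_real (mehler_kernel t x y) * cutoff E u y)")
          (auto intro: integral_norm_bound_ennreal simp: not_integrable_integral_eq)
      also have "\<dots> = W x"
        unfolding W_def by (intro nn_integral_cong) (simp add: norm_mult wn mehler_kernel_nonneg ennreal_mult w0)
      finally show ?thesis .
    qed
    have "(\<integral>\<^sup>+ x. ennreal (norm (cutoff F (OU_semigroup t (cutoff E u)) x) powr 2) \<partial>gauss)
      \<le> (\<integral>\<^sup>+ x. (SUP k. ennreal (indicator F x * (ou t (f k) x)\<^sup>2)) \<partial>gauss)"
    proof (rule nn_integral_mono)
      fix x :: "real ^ 'n"
      show "ennreal (norm (cutoff F (OU_semigroup t (cutoff E u)) x) powr 2)
        \<le> (SUP k. ennreal (indicator F x * (ou t (f k) x)\<^sup>2))"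
      proof (cases "x \<in> F")
        case True
        have "ennreal (norm (cutoff F (OU_semigroup t (cutoff E u)) x) powr 2)
          = ennreal (norm (OU_semigroup t (cutoff E u) x)) * ennreal (norm (OU_semigroup t (cutoff E u) x))"
          using True by (simp add: cutoff_def ennreal_mult[symmetric] power2_eq_square)
        also have "\<dots> \<le> W x * W x" by (intro mult_mono OUW) auto
        also have "\<dots> \<le> (SUP k. ennreal (ou t (f k) x) * ennreal (ou t (f k) x))"
          unfolding Wsup by (rule SUP_mult_self_le[OF Winc])
        also have "\<dots> = (SUP k. ennreal (indicator F x * (ou t (f k) x)\<^sup>2))"
          using True ou_bounds(1)[OF t fm fb] by (simp add: ennreal_mult power2_eq_square)
        finally show ?thesis .
      qed (simp add: cutoff_def)
    qed
    also have "\<dots> = (SUP k. \<integral>\<^sup>+ x. ennreal (indicator F x * (ou t (f k) x)\<^sup>2) \<partial>gauss)"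
    proof (rule nn_integral_monotone_convergence_SUP)
      show "incseq (\<lambda>k x. ennreal (indicator F x * (ou t (f k) x)\<^sup>2))"
        unfolding incseq_def le_fun_def
      proof (intro allI impI ennreal_leI mult_left_mono power_mono)
        fix m n :: nat and x :: "real ^ 'n" assume "m \<le> n"
        then show "ou t (f m) x \<le> ou t (f n) x"
          using incseqD[OF Winc, of m n x] ou_bounds(1)[OF t fm fb] by simp
      qed (use ou_bounds(1)[OF t fm fb] in auto)
      show "(\<lambda>x. ennreal (indicator F x * (ou t (f k) x)\<^sup>2)) \<in> borel_measurable gauss" for k
        using borel_measurable_ou[OF t fm fb, of k] by measurable
    qed
    also have "\<dots> \<le> ennreal R"
    proof (rule SUP_least)
      fix k
      have [measurable]: "ou t (f k) \<in> borel_measurable borel" by (rule borel_measurable_ou[OF t fm fb])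
      have "integrable gauss (\<lambda>x. indicator F x * (ou t (f k) x)\<^sup>2)"
        using ou_bounds[OF t fm fb, of k] by (intro G.integrable_const_bound[where B="(real k)\<^sup>2"])
          (auto intro!: AE_I2 power_mono split: split_indicator)
      then have "(\<integral>\<^sup>+ x. ennreal (indicator F x * (ou t (f k) x)\<^sup>2) \<partial>gauss)
        = ennreal (\<integral>x. indicator F x * (ou t (f k) x)\<^sup>2 \<partial>gauss)"
        by (intro nn_integral_eq_integral) auto
      then show "(\<integral>\<^sup>+ x. ennreal (indicator F x * (ou t (f k) x)\<^sup>2) \<partial>gauss) \<le> ennreal R"
        using trunc[of k] by (simp add: ennreal_leI)
    qed
    finally have fin: "(\<integral>\<^sup>+ x. ennreal (norm (cutoff F (OU_semigroup t (cutoff E u)) x) powr 2) \<partial>gauss) \<le> ennreal R" .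
    have R0: "0 \<le> R" by (simp add: R_def)
    have "Lp_norm 2 gauss (cutoff F (OU_semigroup t (cutoff E u))) \<le> ennreal (sqrt R)"
    proof -
      let ?I = "\<integral>\<^sup>+ x. ennreal (norm (cutoff F (OU_semigroup t (cutoff E u)) x) powr 2) \<partial>gauss"
      have "?I < \<infinity>" using fin by (rule le_less_trans) simp
      moreover have "enn2real ?I \<le> R" using fin R0 by (rule enn2real_leI[rotated])
      ultimately show ?thesis
        unfolding Lp_norm_def Let_def by (auto simp: powr_half_sqrt intro!: ennreal_leI)
    qed
    also have "sqrt R = a powr (1 - ?\<theta>) * J powr (1 / p)"
    proof -
      have "J powr (2 / p) = (J powr (1 / p))\<^sup>2" by (simp add: power2_eq_square powr_add[symmetric])
      then show ?thesis by (simp add: R_def real_sqrt_mult)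
    qed
    also have "ennreal \<dots> = ennreal (a powr (1 - ?\<theta>)) * Lp_norm p gauss (cutoff E u)"
      using iw by (subst Lp_norm_eq_integral) (auto simp: wn J_def ennreal_mult)
    finally show ?thesis using False by (simp add: offdiag_rhs_def a_def)
  qed
  then show ?thesis using \<theta> by blast
qed

end
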